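(* Let $F(z)$ be a monic $p\times p$ matrix polynomial of degree at least $1$ with even part $F_e(z)$ and odd part $F_o(z)$. Assume that $F_o(z)$ is regular when $\deg F$ is even, and that the rational matrix function $\widetilde R_{z,F}(z)=-F_e(z)\,(zF_o(z))^{-1}$, $z\notin\sigma(F_o)\cup\{0\}$, is self-adjoint. Then $F(z)$ is Hurwitz stable if and only if the following statements are simultaneously true: (a) $\widetilde R_{z,F}(z)$ is a matrix-valued Herglotz-Nevanlinna function; (b) $F_e(z)$ and $F_o(z)$ are right coprime; (c) all zeros of $F_o(z)$ are negative real; (d) $0\notin\sigma(F_e)$ (i.e. $\det F_e(0)\ne0$); (e) $\lim_{z\to\infty}\widetilde R_{z,F}(z)\prec0$ when $\deg F$ is even. In this case, $F_o(z)$ is simple.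
   Context: Here $p\in\mathbb N$; $^*$ is the conjugate transpose; $\prec0$ means self-adjoint and negative definite, $\succeq0$ nonnegative definite. A $p\times p$ matrix polynomial $F(z)=\sum_{k=0}^nA_kz^{n-k}$ with $A_k\in\mathbb C^{p\times p}$, $A_0\ne0_p$, has degree $\deg F=n$; it is monic if $A_0=I_p$, and regular if $\det F\not\equiv0$. A zero of a regular $F$ is a $\lambda\in\mathbb C$ with $\det F(\lambda)=0$ (multiplicity: as a root of $\det F$); $\sigma(F)$ is the set of zeros. A regular $F$ is Hurwitz stable if $\sigma(F)$ lies in the open left half-plane. $F$ is simple if it is regular and, for every zero $\lambda$, the multiplicity of $\lambda$ equals the nullity of $F(\lambda)$. The even part $F_e$ and odd part $F_o$ of $F$ are the matrix polynomials with $F(z)=F_e(z^2)+zF_o(z^2)$. For monic $F$, $F_e$ is monic if $\deg F$ is even and $F_o$ is monic if $\deg F$ is odd. $G$ is a right divisor of $F$ if $F=CG$ for some matrix polynomial $C$. A right common divisor of $F$ and $\widetilde F$ is a right divisor of both; it is a greatest right common divisor (GRCD) if every other right common divisor is a right divisor of it. $F$ and $\widetilde F$ are right coprime if any GRCD of them is unimodular, i.e. its determinant never vanishes in $\mathbb C$. A rational matrix function $R$ (entries are complex rational functions) is self-adjoint if $R(z)=R(\bar z)^*$ for all $z\in\mathbb C$ except the poles of its entries. $R$ is a matrix-valued Herglotz-Nevanlinna function if it is holomorphic on the open upper half-plane $\mathbb C_+$ and $\frac1{2\mathrm i}(R(z)-R(z)^* )\succeq0$ for all $z\in\mathbb C_+$.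 *)

theory Defs
  imports
    "HOL-Analysis.Analysis"
    "HOL-Computational_Algebra.Normalized_Fraction"
    "HOL-Computational_Algebra.Polynomial_Factorial"
    "HOL-Computational_Algebra.Field_as_Ring"
begin

section \<open>Complex matrices\<close>

definition ctranspose :: "complex^'n^'m \<Rightarrow> complex^'m^'n" where
  "ctranspose A = map_matrix cnj (transpose A)"

definition self_adjoint :: "complex^'n^'n \<Rightarrow> bool" where
  "self_adjoint A \<longleftrightarrow> ctranspose A = A"

definition sesq_form :: "complex^'n^'n \<Rightarrow> complex^'n \<Rightarrow> complex" where
  "sesq_form A v = (\<Sum>i\<in>UNIV. cnj (v $ i) * (A *v v) $ i)"

text \<open>For self-adjoint \<^term>\<open>A\<close> the value \<^term>\<open>sesq_form A v\<close> is real, so taking the real part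
  loses nothing in the following two definitions.\<close>

definition nonneg_definite :: "complex^'n^'n \<Rightarrow> bool" where
  "nonneg_definite A \<longleftrightarrow> self_adjoint A \<and> (\<forall>v. 0 \<le> Re (sesq_form A v))"

definition neg_definite :: "complex^'n^'n \<Rightarrow> bool" where
  "neg_definite A \<longleftrightarrow> self_adjoint A \<and> (\<forall>v. v \<noteq> 0 \<longrightarrow> Re (sesq_form A v) < 0)"

definition nullity :: "'a::field^'n^'m \<Rightarrow> nat" where
  "nullity A = vec.dim {v. A *v v = 0}"


section \<open>Matrix polynomials\<close>

definition meval :: "complex poly^'n^'n \<Rightarrow> complex \<Rightarrow> complex^'n^'n" where
  "meval F z = map_matrix (\<lambda>q. poly q z) F"

definition mcoeff :: "complex poly^'n^'n \<Rightarrow> nat \<Rightarrow> complex^'n^'n" where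
  "mcoeff F k = map_matrix (\<lambda>q. coeff q k) F"

definition mdegree :: "complex poly^'n^'n \<Rightarrow> nat" where
  "mdegree F = Max {degree (F $ i $ j) | i j. True}"

definition mmonic :: "complex poly^'n^'n \<Rightarrow> bool" where
  "mmonic F \<longleftrightarrow> mcoeff F (mdegree F) = mat 1"

definition mregular :: "complex poly^'n^'n \<Rightarrow> bool" where
  "mregular F \<longleftrightarrow> det F \<noteq> 0"

definition mzeros :: "complex poly^'n^'n \<Rightarrow> complex set" where
  "mzeros F = {z. det (meval F z) = 0}"

definition hurwitz_stable :: "complex poly^'n^'n \<Rightarrow> bool" where
  "hurwitz_stable F \<longleftrightarrow> mregular F \<and> (\<forall>z\<in>mzeros F. Re z < 0)"

definition msimple :: "complex poly^'n^'n \<Rightarrow> bool" where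
  "msimple F \<longleftrightarrow> mregular F \<and> (\<forall>z\<in>mzeros F. order z (det F) = nullity (meval F z))"

lemma det_meval: "det (meval F z) = poly (det F) z"
  by (simp add: det_def meval_def poly_sum poly_prod)

lemma meval_mult: "meval (F ** G) z = meval F z ** meval G z"
  by (simp add: vec_eq_iff matrix_matrix_mult_def meval_def poly_sum)


subsection \<open>Even and odd part\<close>

definition even_part :: "complex poly^'n^'n \<Rightarrow> complex poly^'n^'n" where
  "even_part F = map_matrix (\<lambda>q. \<Sum>k\<le>degree q. monom (coeff q (2 * k)) k) F"

definition odd_part :: "complex poly^'n^'n \<Rightarrow> complex poly^'n^'n" where
  "odd_part F = map_matrix (\<lambda>q. \<Sum>k\<le>degree q. monom (coeff q (2 * k + 1)) k) F"

lemma mcoeff_even_part: "mcoeff (even_part F) k = mcoeff F (2 * k)"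
  by (auto simp: vec_eq_iff mcoeff_def even_part_def coeff_sum intro!: coeff_eq_0)

lemma mcoeff_odd_part: "mcoeff (odd_part F) k = mcoeff F (2 * k + 1)"
  by (auto simp: vec_eq_iff mcoeff_def odd_part_def coeff_sum intro!: coeff_eq_0)

lemma even_odd_unique_poly:
  fixes p e d :: "complex poly"
  shows "p = pcompose e (monom 1 2) + monom 1 1 * pcompose d (monom 1 2) \<longleftrightarrow>
    (\<forall>k. coeff e k = coeff p (2 * k)) \<and> (\<forall>k. coeff d k = coeff p (2 * k + 1))"
proof -
  have c: "coeff (pcompose q (monom 1 2)) k = (if even k then coeff q (k div 2) else 0)"
    for q :: "complex poly" and k
  proof (induction q arbitrary: k)
    case 0
    then show ?case by simp
  next
    case (pCons a q)
    show ?case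
    proof (cases k)
      case 0
      then show ?thesis by (simp add: pcompose_pCons coeff_monom_mult)
    next
      case (Suc m)
      then show ?thesis
        by (cases m) (auto simp: pcompose_pCons coeff_monom_mult pCons.IH coeff_pCons split: nat.splits)
    qed
  qed
  have r: "coeff (pcompose e (monom 1 2) + monom 1 1 * pcompose d (monom 1 2)) k =
    (if even k then coeff e (k div 2) else coeff d (k div 2))" for k
    by (cases k) (simp_all add: c coeff_monom_mult poly_0_coeff_0)
  have "p = pcompose e (monom 1 2) + monom 1 1 * pcompose d (monom 1 2) \<longleftrightarrow>
    (\<forall>k. coeff p k = (if even k then coeff e (k div 2) else coeff d (k div 2)))"
    by (simp only: poly_eq_iff r)
  also have "\<dots> \<longleftrightarrow> (\<forall>k. coeff e k = coeff p (2 * k)) \<and> (\<forall>k. coeff d k = coeff p (2 * k + 1))"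
  proof safe
    fix k
    assume *: "\<forall>k. coeff p k = (if even k then coeff e (k div 2) else coeff d (k div 2))"
    show "coeff e k = coeff p (2 * k)" using *[rule_format, of "2 * k"] by simp
    show "coeff d k = coeff p (2 * k + 1)" using *[rule_format, of "2 * k + 1"] by simp
  next
    fix k
    assume "\<forall>k. coeff e k = coeff p (2 * k)" "\<forall>k. coeff d k = coeff p (2 * k + 1)"
    thus "coeff p k = (if even k then coeff e (k div 2) else coeff d (k div 2))"
      by simp
  qed
  finally show ?thesis .
qed

text \<open>The two parts are characterised by the decomposition $F(z) = F_e(z^2) + z F_o(z^2)$.\<close>

lemma even_odd_part_unique:
  "(\<forall>z. meval F z = meval E (z\<^sup>2) + mat z ** meval D (z\<^sup>2)) \<longleftrightarrow>
    E = even_part F \<and> D = odd_part F"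
proof -
  have "(\<forall>z. meval F z = meval E (z\<^sup>2) + mat z ** meval D (z\<^sup>2)) \<longleftrightarrow>
    (\<forall>i j z. poly (F $ i $ j) z = poly (E $ i $ j) (z\<^sup>2) + z * poly (D $ i $ j) (z\<^sup>2))"
    by (auto simp: vec_eq_iff meval_def mat_def matrix_matrix_mult_def if_distrib
        if_distribR cong: if_cong)
  also have "\<dots> \<longleftrightarrow> (\<forall>i j. F $ i $ j =
      pcompose (E $ i $ j) (monom 1 2) + monom 1 1 * pcompose (D $ i $ j) (monom 1 2))"
    by (simp add: poly_eq_poly_eq_iff[symmetric] fun_eq_iff poly_pcompose poly_monom)
  also have "\<dots> \<longleftrightarrow> (\<forall>k. mcoeff E k = mcoeff (even_part F) k) \<and> (\<forall>k. mcoeff D k = mcoeff (odd_part F) k)"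
    unfolding even_odd_unique_poly mcoeff_even_part mcoeff_odd_part
    by (auto simp: vec_eq_iff mcoeff_def)
  also have "\<dots> \<longleftrightarrow> E = even_part F \<and> D = odd_part F"
    by (auto simp: vec_eq_iff mcoeff_def poly_eq_iff)
  finally show ?thesis .
qed


subsection \<open>Right divisors\<close>

definition right_divisor :: "complex poly^'n^'n \<Rightarrow> complex poly^'n^'n \<Rightarrow> bool" where
  "right_divisor G F \<longleftrightarrow> (\<exists>C. F = C ** G)"

definition right_common_divisor :: "complex poly^'n^'n \<Rightarrow> complex poly^'n^'n \<Rightarrow> complex poly^'n^'n \<Rightarrow> bool" where
  "right_common_divisor D F G \<longleftrightarrow> right_divisor D F \<and> right_divisor D G"

definition is_grcd :: "complex poly^'n^'n \<Rightarrow> complex poly^'n^'n \<Rightarrow> complex poly^'n^'n \<Rightarrow> bool" where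
  "is_grcd D F G \<longleftrightarrow> right_common_divisor D F G \<and>
     (\<forall>D'. right_common_divisor D' F G \<longrightarrow> right_divisor D' D)"

definition munimodular :: "complex poly^'n^'n \<Rightarrow> bool" where
  "munimodular D \<longleftrightarrow> (\<forall>z. det (meval D z) \<noteq> 0)"

definition right_coprime :: "complex poly^'n^'n \<Rightarrow> complex poly^'n^'n \<Rightarrow> bool" where
  "right_coprime F G \<longleftrightarrow> (\<forall>D. is_grcd D F G \<longrightarrow> munimodular D)"


section \<open>Rational matrix functions\<close>

text \<open>A rational function is an element of the fraction field of the polynomials. Its
  representation \<^const>\<open>quot_of_fract\<close> is reduced to lowest terms, so the poles are exactly the
  zeros of the denominator and removable singularities are filled in by evaluation.
  At a pole, evaluation returns the dummy value 0.\<close>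

definition rat_pole :: "complex poly fract \<Rightarrow> complex \<Rightarrow> bool" where
  "rat_pole r z \<longleftrightarrow> poly (snd (quot_of_fract r)) z = 0"

definition rat_eval :: "complex poly fract \<Rightarrow> complex \<Rightarrow> complex" where
  "rat_eval r z = poly (fst (quot_of_fract r)) z / poly (snd (quot_of_fract r)) z"

definition rmat_poles :: "complex poly fract^'n^'n \<Rightarrow> complex set" where
  "rmat_poles R = {z. \<exists>i j. rat_pole (R $ i $ j) z}"

definition rmat_eval :: "complex poly fract^'n^'n \<Rightarrow> complex \<Rightarrow> complex^'n^'n" where
  "rmat_eval R z = map_matrix (\<lambda>r. rat_eval r z) R"

definition rmat_self_adjoint :: "complex poly fract^'n^'n \<Rightarrow> bool" where
  "rmat_self_adjoint R \<longleftrightarrow>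
     (\<forall>z. z \<notin> rmat_poles R \<longrightarrow> rmat_eval R z = ctranspose (rmat_eval R (cnj z)))"

definition herglotz_nevanlinna :: "complex poly fract^'n^'n \<Rightarrow> bool" where
  "herglotz_nevanlinna R \<longleftrightarrow>
     rmat_poles R \<inter> {z. Im z > 0} = {} \<and>
     (\<forall>i j. (\<lambda>z. rmat_eval R z $ i $ j) holomorphic_on {z. Im z > 0}) \<and>
     (\<forall>z. Im z > 0 \<longrightarrow>
        nonneg_definite (mat (1 / (2 * \<i>)) ** (rmat_eval R z - ctranspose (rmat_eval R z))))"

definition rmat_of_mpoly :: "complex poly^'n^'n \<Rightarrow> complex poly fract^'n^'n" where
  "rmat_of_mpoly F = map_matrix to_fract F"

text \<open>$\widetilde R_{z,F}(z) = - F_e(z) (z F_o(z))^{-1}$, the inverse being taken over the field of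
  rational functions; it is meaningful if the odd part is regular.\<close>

definition Rtilde :: "complex poly^'n^'n \<Rightarrow> complex poly fract^'n^'n" where
  "Rtilde F = - (rmat_of_mpoly (even_part F) **
     matrix_inv (rmat_of_mpoly (mat [:0, 1:] ** odd_part F)))"

lemma rat_eval_quotient:
  assumes "poly b z \<noteq> 0"
  shows "rat_eval (to_fract a / to_fract b) z = poly a z / poly b z"
    and "\<not> rat_pole (to_fract a / to_fract b) z"
proof -
  define r where "r = to_fract a / to_fract b"
  obtain n d where nd: "quot_of_fract r = (n, d)" by (cases "quot_of_fract r")
  have d: "d \<noteq> 0" using nd snd_quot_of_fract_nonzero[of r] by simp
  have b: "b \<noteq> 0" using assms by auto
  have cop: "coprime n d" using nd coprime_quot_of_fract[of r] by simp
  have "r = to_fract n / to_fract d"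
    using nd quot_to_fract_quot_of_fract[of r] by (simp add: quot_to_fract_def Fract_conv_to_fract)
  hence "to_fract (a * d) = to_fract (n * b)"
    using b d unfolding r_def by (simp add: field_simps)
  hence eq: "a * d = n * b" by (simp only: to_fract_eq_iff)
  hence "d dvd n * b" by (metis dvd_triv_right)
  hence "d dvd b" using cop by (simp add: coprime_dvd_mult_right_iff coprime_commute)
  hence dz: "poly d z \<noteq> 0" using assms by (auto elim!: dvdE)
  have "poly a z * poly d z = poly n z * poly b z" by (metis eq poly_mult)
  thus "rat_eval (to_fract a / to_fract b) z = poly a z / poly b z"
    and "\<not> rat_pole (to_fract a / to_fract b) z"
    unfolding r_def[symmetric] rat_eval_def rat_pole_def nd using dz assms
    by (simp_all add: field_simps)
qed

lemma det_rmat_of_mpoly: "det (rmat_of_mpoly F) = to_fract (det F)"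
proof -
  have s: "to_fract (sum f A) = (\<Sum>x\<in>A. to_fract (f x))" for f :: "'x \<Rightarrow> complex poly" and A
    by (induction A rule: infinite_finite_induct) auto
  have p: "to_fract (prod f A) = (\<Prod>x\<in>A. to_fract (f x))" for f :: "'x \<Rightarrow> complex poly" and A
    by (induction A rule: infinite_finite_induct) auto
  have o: "to_fract (of_int (sign q)) = of_int (sign q)" for q :: "'x \<Rightarrow> 'x"
    by (simp add: sign_def)
  show ?thesis
    by (simp add: det_def rmat_of_mpoly_def s p o)
qed

lemma rmat_of_mpoly_mult: "rmat_of_mpoly (F ** G) = rmat_of_mpoly F ** rmat_of_mpoly G"
proof -
  have s: "to_fract (sum f A) = (\<Sum>x\<in>A. to_fract (f x))" for f :: "'x \<Rightarrow> complex poly" and A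
    by (induction A rule: infinite_finite_induct) auto
  show ?thesis
    by (simp add: vec_eq_iff matrix_matrix_mult_def rmat_of_mpoly_def s)
qed

lemma matrix_inv_det_nz:
  fixes A :: "'a::field^'n^'n"
  assumes "det A \<noteq> 0"
  shows "A ** matrix_inv A = mat 1 \<and> matrix_inv A ** A = mat 1"
  using assms unfolding invertible_det_nz[symmetric] invertible_def matrix_inv_def by (rule someI_ex)

text \<open>The matrix over the fraction field evaluates to the pointwise expression wherever the
  latter makes sense.\<close>

lemma rmat_eval_Rtilde:
  fixes F :: "complex poly^'n^'n"
  assumes "z \<notin> mzeros (odd_part F) \<union> {0}"
  shows "z \<notin> rmat_poles (Rtilde F)"
    and "rmat_eval (Rtilde F) z =
      - (meval (even_part F) z ** matrix_inv (mat z ** meval (odd_part F) z))"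
proof -
  define N where "N = mat [:0, 1:] ** odd_part F"
  define d where "d = det N"
  define M where "M = rmat_of_mpoly N"
  have Nz: "meval N z = mat z ** meval (odd_part F) z"
    unfolding N_def meval_mult
    by (simp add: vec_eq_iff meval_def mat_def matrix_matrix_mult_def if_distrib[of "\<lambda>q. poly q z"]
        cong: if_cong)
  have "det (mat z :: complex^'n^'n) \<noteq> 0"
    using assms det_diagonal[of "mat z :: complex^'n^'n"] by (simp add: mat_def)
  hence dNz: "det (meval N z) \<noteq> 0"
    using assms unfolding Nz det_mul by (simp add: mzeros_def)
  hence dz: "poly d z \<noteq> 0" by (simp add: d_def det_meval)
  hence d0: "d \<noteq> 0" by auto
  have dM: "det M = to_fract d" by (simp add: M_def d_def det_rmat_of_mpoly)
  have dM0: "det M \<noteq> 0" using d0 by (simp add: dM)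
  have inv: "M ** matrix_inv M = mat 1" "matrix_inv M ** M = mat 1"
    using matrix_inv_det_nz[OF dM0] by simp_all
  define A where "A = (\<chi> k j. det (\<chi> i l. if l = k then (if i = j then 1 else 0) else N $ i $ l))"
  have A: "matrix_inv M $ k $ j = to_fract (A $ k $ j) / to_fract d" for k j
  proof -
    have col: "M *v column j (matrix_inv M) = axis j 1"
      using inv(1) by (simp add: vec_eq_iff matrix_matrix_mult_def matrix_vector_mult_def
          column_def mat_def axis_def)
    have "det (\<chi> i l. if l = k then axis j 1 $ i else M $ i $ l) = matrix_inv M $ k $ j * det M"
      using cramer_lemma[of k M "column j (matrix_inv M)"] unfolding col by (simp add: column_def)
    hence "matrix_inv M $ k $ j = det (\<chi> i l. if l = k then axis j 1 $ i else M $ i $ l) / det M"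
      using dM0 by simp
    also have "(\<chi> i l. if l = k then axis j 1 $ i else M $ i $ l) =
      rmat_of_mpoly (\<chi> i l. if l = k then (if i = j then 1 else 0) else N $ i $ l)"
      by (simp add: vec_eq_iff rmat_of_mpoly_def M_def axis_def)
    finally show ?thesis by (simp add: det_rmat_of_mpoly A_def dM)
  qed
  define B where "B = - (even_part F ** A)"
  have s: "to_fract (sum f X) = (\<Sum>x\<in>X. to_fract (f x))" for f :: "'x \<Rightarrow> complex poly" and X
    by (induction X rule: infinite_finite_induct) auto
  have B: "Rtilde F $ i $ j = to_fract (B $ i $ j) / to_fract d" for i j
    unfolding Rtilde_def N_def[symmetric] M_def[symmetric] B_def
    by (simp add: matrix_matrix_mult_def A rmat_of_mpoly_def s sum_divide_distrib)
  show "z \<notin> rmat_poles (Rtilde F)"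
    using rat_eval_quotient(2)[OF dz] by (simp add: rmat_poles_def B)
  have R: "rmat_eval (Rtilde F) z $ i $ j = meval B z $ i $ j / poly d z" for i j
    using rat_eval_quotient(1)[OF dz] by (simp add: rmat_eval_def B meval_def)
  have "rmat_of_mpoly (A ** N) = rmat_of_mpoly (mat d)"
  proof -
    have "rmat_of_mpoly A = (\<chi> k j. to_fract d * matrix_inv M $ k $ j)"
      using d0 by (simp add: vec_eq_iff A rmat_of_mpoly_def)
    also have "\<dots> ** M = (\<chi> k j. to_fract d * (matrix_inv M ** M) $ k $ j)"
      by (simp add: vec_eq_iff matrix_matrix_mult_def sum_distrib_left mult.assoc)
    also have "\<dots> = rmat_of_mpoly (mat d)"
      unfolding inv(2) by (simp add: vec_eq_iff mat_def rmat_of_mpoly_def)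
    finally show ?thesis by (simp add: rmat_of_mpoly_mult M_def)
  qed
  hence AN: "A ** N = mat d" by (simp add: vec_eq_iff rmat_of_mpoly_def)
  have mm: "meval (mat d) z = (mat (poly d z) :: complex^'n^'n)"
    by (simp add: vec_eq_iff meval_def mat_def)
  have AzN: "meval A z ** meval N z = mat (poly d z)"
    using arg_cong[OF AN, of "\<lambda>X. meval X z"] by (simp add: meval_mult mm)
  have iN: "meval N z ** matrix_inv (meval N z) = mat 1"
    using matrix_inv_det_nz[OF dNz] by simp
  have "meval A z = mat (poly d z) ** matrix_inv (meval N z)"
    using AzN iN by (metis matrix_mul_assoc matrix_mul_rid)
  hence Az: "meval A z $ k $ j = poly d z * matrix_inv (meval N z) $ k $ j" for k j
    by (simp add: matrix_matrix_mult_def mat_def if_distrib if_distribR sum.delta cong: if_cong)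
  have "meval B z = - (meval (even_part F) z ** meval A z)"
    unfolding B_def meval_mult[symmetric] by (simp add: vec_eq_iff meval_def)
  hence "meval B z $ i $ j = - (poly d z * (meval (even_part F) z ** matrix_inv (meval N z)) $ i $ j)"
    for i j
    by (simp add: matrix_matrix_mult_def Az sum_distrib_left mult_ac)
  thus "rmat_eval (Rtilde F) z =
      - (meval (even_part F) z ** matrix_inv (mat z ** meval (odd_part F) z))"
    using dz by (simp add: vec_eq_iff R Nz)
qed

end

theory Submission
  imports Defs "HOL-Complex_Analysis.Complex_Analysis"
begin

text \<open>Self-adjointness makes $F_o^* F_e$ Hermitian on the real line, so $\|F(-z) x\| = \|F(z) x\|$ on
  the imaginary axis. If \<open>F\<close> is stable, the maximum principle turns this into
  $\|F(-z) x\| \le \|F(z) x\|$ on the right half-plane, which says that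
  $H(s) = F_e(s^2) F_o(s^2)^{-1} / s$ has nonnegative Hermitian part there; moreover $H$ is
  Hermitian on the positive axis. By the Schwarz-Pick lemma the forms $h(s) = u^* H(s) u$ satisfy
  $|\arg h(s)| \le |\arg s|$, which is the Herglotz-Nevanlinna property of $-H(s)/s$ in the variable
  $s^2$, and $|h(s)| \le h(1) (|s| + 1)^2 / \mathrm{Re}\, s$, which makes all poles simple: the finite ones
  (simplicity of $F_o$), the one at \<open>0\<close> (absence of the zero \<open>0\<close>) and the one at infinity (the
  limit condition).

  Conversely, if $F(z) v = 0$ and $u = F_o(z^2) v \ne 0$, then $\widetilde R(z^2) u = z^{-1} u$. For
  $\mathrm{Re}\, z > 0$ this contradicts the sign of the imaginary part if $z$ is not real, and the
  monotonicity of $\widetilde R$ on the positive axis if it is. On the imaginary axis hermiticity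
  forces a common kernel vector of $F_e$ and $F_o$, excluded by coprimeness.\<close>

section \<open>The Hermitian inner product\<close>

text \<open>Before H can be formed, F_o(s^2) must be invertible for Re s > 0, which stability does
  not show directly; the equality case of the maximum principle supplies it. Mere positivity of the
  real part of h would not be enough for the Herglotz property in the variable s^2: one needs arg h
  controlled by arg s, and that is where realness on the positive axis enters. The growth bound
  works because a double pole at an imaginary point s0 would make H grow like t^(-2) along s0 + t,
  whereas only t^(-1) is allowed. The bound concerns quadratic forms, so polarization turns it into
  a norm bound, and it is then tested on vectors: a kernel vector of F_o at which the bound forces
  F_e to vanish too would be a kernel vector of F. Simplicity is accordingly reduced to the absence
  of Jordan chains of length two. Coprimeness quantifies over all greatest common divisors and would
  be vacuous if there were none, so existence together with a Bezout identity has to be shown. In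
  the converse, odd degree gives limit 0 at infinity, so one monotonicity argument serves both
  parities.\<close>

definition hip :: "complex^'n \<Rightarrow> complex^'n \<Rightarrow> complex" where
  "hip x y = (\<Sum>i\<in>UNIV. cnj (x $ i) * y $ i)"

lemma sesq_form_eq_hip: "sesq_form A v = hip v (A *v v)"
  by (simp add: sesq_form_def hip_def)

lemma hip_0 [simp]: "hip 0 y = 0" "hip x 0 = 0"
  by (simp_all add: hip_def)

lemma hip_add: "hip (x + y) z = hip x z + hip y z" "hip x (y + z) = hip x y + hip x z"
  by (simp_all add: hip_def algebra_simps sum.distrib)

lemma hip_minus: "hip (- x) z = - hip x z" "hip x (- z) = - hip x z"
  by (simp_all add: hip_def sum_negf)

lemma hip_diff: "hip (x - y) z = hip x z - hip y z" "hip x (y - z) = hip x y - hip x z"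
  by (simp_all add: hip_def algebra_simps sum_subtractf)

lemma hip_scale: "hip (c *s x) y = cnj c * hip x y" "hip x (c *s y) = c * hip x y"
  by (simp_all add: hip_def sum_distrib_left mult_ac)

lemma cnj_hip: "cnj (hip x y) = hip y x"
  by (simp add: hip_def mult_ac)

text \<open>The type-class inner product on complex vectors is the real one; this link makes its
  norm identities available for \<open>hip\<close>.\<close>

lemma Re_hip: "Re (hip x y) = x \<bullet> y"
  by (simp add: hip_def inner_vec_def inner_complex_def)

lemma Re_hip_commute: "Re (hip x y) = Re (hip y x)"
  by (simp add: Re_hip inner_commute)

lemma hip_self: "hip x x = of_real ((norm x)\<^sup>2)"
proof -
  have "Im (hip x x) = 0"
    using cnj_hip[of x x] by (simp add: complex_eq_iff)
  thus ?thesis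
    by (simp add: complex_eq_iff Re_hip power2_norm_eq_inner)
qed

lemma norm_hip_le: "norm (hip x y) \<le> norm x * norm y"
proof -
  have "norm (hip x y) \<le> (\<Sum>i\<in>UNIV. \<bar>norm (x $ i)\<bar> * \<bar>norm (y $ i)\<bar>)"
    unfolding hip_def by (rule order_trans[OF norm_sum]) (simp add: norm_mult)
  also have "\<dots> \<le> norm x * norm y"
    unfolding norm_vec_def by (rule L2_set_mult_ineq)
  finally show ?thesis .
qed

lemma norm_scale_vec: "norm (c *s x) = norm c * norm x" for x :: "complex^'n"
proof -
  have "of_real ((norm (c *s x))\<^sup>2) = (of_real ((norm c * norm x)\<^sup>2) :: complex)"
    unfolding hip_self[symmetric] hip_scale
    using complex_norm_square[of c] by (simp add: hip_self power_mult_distrib mult_ac)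
  hence "(norm (c *s x))\<^sup>2 = (norm c * norm x)\<^sup>2"
    by (simp only: of_real_eq_iff)
  thus ?thesis by simp
qed

lemma hip_ctranspose: "hip (ctranspose A *v x) y = hip x (A *v y)"
proof -
  have "hip (ctranspose A *v x) y = (\<Sum>j\<in>UNIV. \<Sum>i\<in>UNIV. cnj (x $ i) * A $ i $ j * y $ j)"
    by (simp add: hip_def ctranspose_def matrix_vector_mult_def transpose_def
        sum_distrib_left sum_distrib_right mult_ac)
  also have "\<dots> = hip x (A *v y)"
    by (subst sum.swap) (simp add: hip_def matrix_vector_mult_def sum_distrib_left mult_ac)
  finally show ?thesis .
qed

lemma hip_ctranspose_right: "hip x (ctranspose A *v y) = hip (A *v x) y"
  using arg_cong[OF hip_ctranspose[of A y x], of cnj] by (simp only: cnj_hip)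

lemma ctranspose_eqI:
  assumes "\<And>x y. hip (B *v x) y = hip x (A *v y)"
  shows "ctranspose A = B"
proof -
  have "hip (ctranspose A *v x - B *v x) y = 0" for x y
    by (simp add: hip_diff hip_ctranspose assms)
  hence "ctranspose A *v x - B *v x = 0" for x
    using hip_self[of "ctranspose A *v x - B *v x"] by simp
  thus ?thesis
    by (simp add: matrix_eq)
qed

lemma mat_vector_mult: "mat c *v x = c *s x"
  by (simp add: vec_eq_iff mat_def matrix_vector_mult_def if_distrib if_distribR cong: if_cong)

lemma scale_matrix_vector_mult: "A *v (c *s x) = c *s (A *v x)" for A :: "'a::comm_semiring_1^'n^'m"
  by (simp add: vec_eq_iff matrix_vector_mult_def sum_distrib_left mult_ac)

lemma det_eq_0_iff_kernel:
  fixes A :: "'a::field^'n^'n"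
  shows "det A = 0 \<longleftrightarrow> (\<exists>v. v \<noteq> 0 \<and> A *v v = 0)"
  using invertible_det_nz[of A] matrix_left_invertible_ker[of A] invertible_left_inverse[of A]
  by metis

lemma matrix_inv_vector_mult:
  fixes A :: "'a::field^'n^'n"
  assumes "det A \<noteq> 0"
  shows "A *v (matrix_inv A *v x) = x" "matrix_inv A *v (A *v x) = x"
  using matrix_inv_det_nz[OF assms] by (simp_all add: matrix_vector_mul_assoc)

lemma matrix_inv_unique:
  fixes A :: "'a::field^'n^'n"
  assumes "A ** B = mat 1"
  shows "matrix_inv A = B"
proof -
  have "det A * det B = 1"
    using arg_cong[OF assms, of det] by (simp add: det_mul)
  hence "det A \<noteq> 0" by auto
  thus ?thesis
    using matrix_inv_det_nz assms by (metis matrix_mul_assoc matrix_mul_lid matrix_mul_rid)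
qed

text \<open>Writing the entries of the inverse as quotients of determinants makes continuity and
  holomorphy of inversion immediate.\<close>

lemma matrix_inv_cramer:
  fixes A :: "'a::field^'n^'n"
  assumes "det A \<noteq> 0"
  shows "matrix_inv A $ k $ j = det (\<chi> i l. if l = k then mat 1 $ i $ j else A $ i $ l) / det A"
proof -
  have col: "A *v column j (matrix_inv A) = column j (mat 1)"
    using matrix_inv_det_nz[OF assms]
    by (simp add: vec_eq_iff matrix_matrix_mult_def matrix_vector_mult_def column_def)
  thus ?thesis
    using cramer_lemma[of k A "column j (matrix_inv A)"] assms unfolding col
    by (simp add: column_def eq_divide_eq cong: if_cong)
qed

section \<open>Continuity and holomorphy of matrix operations\<close>

lemma tendsto_det [tendsto_intros]:
  fixes A :: "'b \<Rightarrow> complex^'n^'n"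
  assumes "(A \<longlongrightarrow> L) F"
  shows "((\<lambda>x. det (A x)) \<longlongrightarrow> det L) F"
  unfolding det_def by (intro tendsto_intros assms)

lemma tendsto_vec_iff:
  fixes f :: "'b \<Rightarrow> 'a::topological_space^'n"
  shows "(f \<longlongrightarrow> L) F \<longleftrightarrow> (\<forall>i. ((\<lambda>x. f x $ i) \<longlongrightarrow> L $ i) F)"
  by (auto intro: tendsto_vec_nth vec_tendstoI)

lemma tendsto_matrix_vector_mult [tendsto_intros]:
  fixes A :: "'b \<Rightarrow> complex^'n^'m"
  assumes "(A \<longlongrightarrow> L) F" "(v \<longlongrightarrow> w) F"
  shows "((\<lambda>x. A x *v v x) \<longlongrightarrow> L *v w) F"
  unfolding tendsto_vec_iff matrix_vector_mult_def
  by (auto intro!: tendsto_intros assms)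

lemma tendsto_matrix_mult [tendsto_intros]:
  fixes A :: "'b \<Rightarrow> complex^'n^'m" and B :: "'b \<Rightarrow> complex^'k^'n"
  assumes "(A \<longlongrightarrow> L) F" "(B \<longlongrightarrow> M) F"
  shows "((\<lambda>x. A x ** B x) \<longlongrightarrow> L ** M) F"
  unfolding tendsto_vec_iff matrix_matrix_mult_def
  by (auto intro!: tendsto_intros assms)

lemma tendsto_hip [tendsto_intros]:
  assumes "(f \<longlongrightarrow> x) F" "(g \<longlongrightarrow> y) F"
  shows "((\<lambda>t. hip (f t) (g t)) \<longlongrightarrow> hip x y) F"
  unfolding hip_def by (intro tendsto_intros assms)

lemma tendsto_scale_vec [tendsto_intros]:
  fixes f :: "'b \<Rightarrow> complex"
  assumes "(f \<longlongrightarrow> c) F" "(g \<longlongrightarrow> y) F"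
  shows "((\<lambda>t. f t *s g t) \<longlongrightarrow> c *s y) F"
  unfolding tendsto_vec_iff by (auto intro!: tendsto_intros assms)

lemma tendsto_matrix_inv [tendsto_intros]:
  fixes A :: "'b \<Rightarrow> complex^'n^'n"
  assumes "(A \<longlongrightarrow> L) F" "det L \<noteq> 0"
  shows "((\<lambda>x. matrix_inv (A x)) \<longlongrightarrow> matrix_inv L) F"
proof -
  have "((\<lambda>x. matrix_inv (A x) $ k $ j) \<longlongrightarrow> matrix_inv L $ k $ j) F" for k j
  proof -
    have "((\<lambda>x. \<chi> i l. if l = k then mat 1 $ i $ j else A x $ i $ l) \<longlongrightarrow>
        (\<chi> i l. if l = k then mat 1 $ i $ j else L $ i $ l)) F"
      unfolding tendsto_vec_iff by (auto intro!: tendsto_intros assms)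
    from tendsto_divide[OF tendsto_det[OF this] tendsto_det[OF assms(1)] assms(2)]
    have "((\<lambda>x. det (\<chi> i l. if l = k then mat 1 $ i $ j else A x $ i $ l) / det (A x)) \<longlongrightarrow>
      matrix_inv L $ k $ j) F"
      using matrix_inv_cramer[OF assms(2)] by simp
    moreover have "eventually (\<lambda>x. det (A x) \<noteq> 0) F"
      using tendsto_det[OF assms(1)] assms(2) by (rule tendsto_imp_eventually_ne)
    hence "eventually (\<lambda>x. det (\<chi> i l. if l = k then mat 1 $ i $ j else A x $ i $ l) / det (A x)
        = matrix_inv (A x) $ k $ j) F"
      by eventually_elim (simp add: matrix_inv_cramer)
    ultimately show ?thesis by (rule Lim_transform_eventually)
  qed
  thus ?thesis by (simp add: tendsto_vec_iff)
qed

lemma holomorphic_det: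
  fixes A :: "complex \<Rightarrow> complex^'n^'n"
  assumes "\<And>i j. (\<lambda>z. A z $ i $ j) holomorphic_on S"
  shows "(\<lambda>z. det (A z)) holomorphic_on S"
  unfolding det_def by (intro holomorphic_intros assms)

lemma holomorphic_matrix_inv:
  fixes A :: "complex \<Rightarrow> complex^'n^'n"
  assumes "\<And>i j. (\<lambda>z. A z $ i $ j) holomorphic_on S" "\<And>z. z \<in> S \<Longrightarrow> det (A z) \<noteq> 0"
  shows "(\<lambda>z. matrix_inv (A z) $ k $ j) holomorphic_on S"
proof -
  have "(\<lambda>z. if l = k then c else A z $ i $ l) holomorphic_on S" for l c i
    using assms(1) by (cases "l = k") auto
  hence "(\<lambda>z. det (\<chi> i l. if l = k then mat 1 $ i $ j else A z $ i $ l) / det (A z)) holomorphic_on S"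
    using assms by (intro holomorphic_on_divide holomorphic_det) auto
  thus ?thesis
    by (rule holomorphic_transform) (simp add: matrix_inv_cramer assms(2))
qed

lemma holomorphic_hip_mult:
  fixes A B :: "complex \<Rightarrow> complex^'n^'n"
  assumes "\<And>i j. (\<lambda>z. A z $ i $ j) holomorphic_on S" "\<And>i j. (\<lambda>z. B z $ i $ j) holomorphic_on S"
  shows "(\<lambda>z. hip y (A z *v (B z *v x))) holomorphic_on S"
  unfolding hip_def matrix_vector_mult_def by (simp, intro holomorphic_intros assms)

text \<open>Complex polarization recovers \<open>hip x (A *v y)\<close> from four values of the
  quadratic form, each at most \<open>K * (norm y + norm x)\<^sup>2\<close>. Taking
  \<open>norm x = norm y\<close> produces the constant 4.\<close>

lemma norm_matrix_le_of_numerical_radius: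
  fixes A :: "complex^'n^'n"
  assumes A: "\<And>u. norm (hip u (A *v u)) \<le> K * (norm u)\<^sup>2" and K: "0 \<le> K"
  shows "norm (A *v y) \<le> 4 * K * norm y"
proof -
  have pol: "4 * hip x (A *v y) = hip (y + x) (A *v (y + x)) - hip (y - x) (A *v (y - x))
      + \<i> * hip (y + \<i> *s x) (A *v (y + \<i> *s x)) - \<i> * hip (y - \<i> *s x) (A *v (y - \<i> *s x))" for x
    by (simp add: hip_add hip_diff hip_scale scale_matrix_vector_mult matrix_vector_mult_diff_distrib
        matrix_vector_right_distrib algebra_simps)
  have le: "norm (hip (y + x) (A *v (y + x))) \<le> K * (norm y + norm x)\<^sup>2" for x
    by (rule order_trans[OF A]) (intro mult_left_mono K power_mono norm_triangle_ineq, auto)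
  have b: "norm (hip x (A *v y)) \<le> K * (norm y + norm x)\<^sup>2" for x
  proof -
    define t where "t = K * (norm y + norm x)\<^sup>2"
    note l = le[of x] le[of "- x"] le[of "\<i> *s x"] le[of "- (\<i> *s x)"]
    have "norm (4 * hip x (A *v y)) \<le> t + t + t + t"
      unfolding pol
      by (intro order_trans[OF norm_triangle_ineq] order_trans[OF norm_triangle_ineq4] add_mono)
        (use l in \<open>simp_all add: norm_mult norm_scale_vec t_def\<close>)
    thus ?thesis by (simp add: norm_mult t_def)
  qed
  show ?thesis
  proof (cases "A *v y = 0 \<or> y = 0")
    case True
    thus ?thesis using K by auto
  next
    case False
    \<comment> \<open>The direction of \<open>A *v y\<close>, rescaled to the length of
      \<open>y\<close>, makes the pairing equal to \<open>norm y * norm (A *v y)\<close>.\<close>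
    define x where "x = (of_real (norm y / norm (A *v y)) :: complex) *s (A *v y)"
    have nx: "norm x = norm y"
      using False by (simp add: x_def norm_scale_vec norm_divide)
    have "hip x (A *v y) = of_real (norm y * norm (A *v y))"
      using False by (simp add: x_def hip_scale hip_self power2_eq_square)
    hence "norm y * norm (A *v y) \<le> K * (norm y + norm y)\<^sup>2"
      using b[of x] by (simp add: nx norm_mult)
    hence "norm y * norm (A *v y) \<le> norm y * (4 * K * norm y)"
      by (simp add: power2_eq_square algebra_simps)
    thus ?thesis using False by (simp add: mult_le_cancel_left)
  qed
qed

lemma matrix_vector_bound:
  fixes A :: "complex^'n^'m"
  shows "\<exists>K\<ge>0. \<forall>x. norm (A *v x) \<le> K * norm x"
proof -
  have "linear ((*v) A)"
    by (rule linearI)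
      (simp_all add: vec_eq_iff matrix_vector_mult_def algebra_simps sum.distrib scaleR_sum_right)
  hence "bounded_linear ((*v) A)"
    by (simp add: linear_conv_bounded_linear)
  then obtain K where "\<And>x. norm (A *v x) \<le> norm x * K" "0 \<le> K"
    using bounded_linear.nonneg_bounded by blast
  thus ?thesis by (metis mult.commute)
qed

text \<open>The form attains its maximum 0 at \<open>v\<close>. Moving from \<open>v\<close> in the
  direction \<open>A *v v\<close> changes it to first order by twice the squared norm of
  \<open>A *v v\<close>, so it would become positive.\<close>

lemma negative_semidefinite_kernel:
  fixes A :: "complex^'n^'n"
  assumes sa: "self_adjoint A" and neg: "\<And>u. Re (hip u (A *v u)) \<le> 0"
    and v: "Re (hip v (A *v v)) = 0"
  shows "A *v v = 0"
proof (rule ccontr)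
  assume "A *v v \<noteq> 0"
  define w a k where "w = A *v v" and "a = (norm w)\<^sup>2" and "k = Re (hip w (A *v w))"
  have a: "a > 0" using \<open>A *v v \<noteq> 0\<close> by (simp add: a_def w_def)
  \<comment> \<open>Small enough that the second-order term \<open>t * k\<close> is at most
    \<open>a\<close> in modulus and cannot outweigh \<open>2 * a\<close>.\<close>
  define t where "t = a / (\<bar>k\<bar> + 1)"
  have t: "t > 0" using a by (simp add: t_def)
  have "hip v (A *v w) = hip w w"
    using hip_ctranspose_right[of v A w] sa by (simp add: self_adjoint_def w_def)
  hence "Re (hip (v + of_real t *s w) (A *v (v + of_real t *s w))) = t * (2 * a + t * k)"
    using v by (simp add: hip_add hip_scale matrix_vector_right_distrib scale_matrix_vector_mult
        flip: w_def) (simp add: hip_self a_def k_def algebra_simps)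
  hence "2 * a + t * k \<le> 0"
    using neg[of "v + of_real t *s w"] t by (simp add: mult_le_0_iff)
  moreover have "\<bar>t * k\<bar> \<le> a"
  proof -
    have "\<bar>t * k\<bar> = a * (\<bar>k\<bar> / (\<bar>k\<bar> + 1))" using a by (simp add: t_def abs_mult)
    also have "\<dots> \<le> a * 1" using a by (intro mult_left_mono) auto
    finally show ?thesis by simp
  qed
  ultimately show False using a by linarith
qed

section \<open>Functions on the right half-plane\<close>

text \<open>The domain is unbounded, so the bounded maximum principle is applied on a large
  half-disc: the limit at infinity controls the arc up to \<open>e\<close>, the hypothesis on the
  imaginary axis controls the diameter.\<close>

lemma maximum_modulus_right_half_plane:
  fixes f :: "complex \<Rightarrow> complex"
  assumes hol: "f holomorphic_on {z. Re z > 0}"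
    and cont: "continuous_on {z. Re z \<ge> 0} f"
    and im: "\<And>z. Re z = 0 \<Longrightarrow> norm (f z) \<le> B"
    and lim: "(f \<longlongrightarrow> l) at_infinity" "norm l \<le> B"
    and s: "Re s \<ge> 0"
  shows "norm (f s) \<le> B"
proof (rule field_le_epsilon)
  fix e :: real
  assume "e > 0"
  hence "eventually (\<lambda>z. dist (f z) l < e) at_infinity"
    using lim(1) by (rule tendstoD[rotated])
  then obtain b where b: "\<And>z. norm z \<ge> b \<Longrightarrow> dist (f z) l < e"
    unfolding eventually_at_infinity by blast
  \<comment> \<open>Large enough for \<open>s\<close> to lie inside the disc and for
    \<open>f\<close> to be within \<open>e\<close> of \<open>l\<close> on the arc.\<close>
  define r where "r = max b (norm s + 1)"
  have far: "norm (f z) \<le> B + e" if "norm z \<ge> r" for z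
  proof -
    have "norm (f z) \<le> norm l + dist (f z) l"
      by (metis dist_norm norm_triangle_sub)
    also have "\<dots> \<le> B + e"
      using b[of z] that lim(2) by (simp add: r_def)
    finally show ?thesis .
  qed
  define S where "S = ball 0 r \<inter> {z. Re z > 0}"
  have opn: "open S"
    unfolding S_def by (intro open_Int open_ball open_halfspace_Re_gt)
  have cls: "closure S \<subseteq> cball 0 r \<inter> {z. Re z \<ge> 0}"
    unfolding S_def by (intro closure_minimal closed_Int closed_cball closed_halfspace_Re_ge) auto
  show "norm (f s) \<le> B + e"
  proof (cases "Re s = 0")
    case True
    thus ?thesis using im[of s] \<open>e > 0\<close> by simp
  next
    case False
    show ?thesis
    proof (rule maximum_modulus_frontier[where S = S and f = f and \<xi> = s])
      show "f holomorphic_on interior S"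
        using hol by (rule holomorphic_on_subset) (use interior_subset S_def in blast)
      show "continuous_on (closure S) f"
        using cont by (rule continuous_on_subset) (use cls in blast)
      show "bounded S" by (simp add: S_def bounded_Int)
      show "s \<in> S"
        using s False by (auto simp: S_def r_def)
      fix z
      assume "z \<in> frontier S"
      hence "z \<in> closure S" "z \<notin> S"
        by (simp_all add: frontier_def interior_open[OF opn])
      hence "norm z = r \<or> Re z = 0"
        using cls by (force simp: S_def)
      thus "norm (f z) \<le> B + e"
        using far[of z] im[of z] \<open>e > 0\<close> by auto
    qed
  qed
qed

section \<open>Schwarz-Pick estimates on the half-plane\<close>

lemma norm_diff_less_norm_add:
  assumes "Re z > 0" "b > 0"
  shows "norm (z - of_real b) < norm (z + of_real b)"
proof -
  have "0 < Re z * b"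
    using assms by simp
  hence "(norm (z - of_real b))\<^sup>2 < (norm (z + of_real b))\<^sup>2"
    unfolding cmod_power2 by (simp add: power2_eq_square algebra_simps)
  thus ?thesis by (rule power_less_imp_less_base) simp
qed

lemma Re_cayley:
  assumes "norm \<xi> < 1"
  shows "Re ((1 + \<xi>) / (1 - \<xi>)) > 0"
proof -
  have "1 - \<xi> \<noteq> 0" using assms by auto
  have "(norm \<xi>)\<^sup>2 < 1" using assms by (simp add: abs_square_less_1)
  hence "(1 + Re \<xi>) * (1 - Re \<xi>) - Im \<xi> * Im \<xi> > 0"
    unfolding cmod_power2 by (simp add: power2_eq_square algebra_simps)
  moreover have "(1 - Re \<xi>)\<^sup>2 + (Im \<xi>)\<^sup>2 > 0"
    using \<open>1 - \<xi> \<noteq> 0\<close> by (auto simp: complex_eq_iff sum_power2_gt_zero_iff)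
  ultimately show ?thesis by (simp add: Re_divide)
qed

text \<open>Cayley transforms carry both half-planes to the unit disc and send \<open>a\<close> and
  \<open>b\<close> to its centre; the Schwarz lemma then compares the images. The result is cleared
  of denominators. Strict positivity gives \<open>b > 0\<close> and puts the image in the open
  disc.\<close>

lemma schwarz_pick_half_plane_strict:
  assumes hol: "h holomorphic_on {z. Re z > 0}"
    and pos: "\<And>z. Re z > 0 \<Longrightarrow> Re (h z) > 0"
    and a: "a > 0" "h (of_real a) = of_real b" and s: "Re s > 0"
  shows "norm (h s - of_real b) * norm (s + of_real a) \<le> norm (h s + of_real b) * norm (s - of_real a)"
proof -
  have b: "b > 0" using pos[of "of_real a"] a by simp
  define c where "c = (\<lambda>\<xi>::complex. of_real a * ((1 + \<xi>) / (1 - \<xi>)))"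
  define f where "f = (\<lambda>\<xi>. (h (c \<xi>) - of_real b) / (h (c \<xi>) + of_real b))"
  have Rc: "Re (c \<xi>) > 0" if "norm \<xi> < 1" for \<xi>
    using mult_pos_pos[OF a(1) Re_cayley[OF that]] by (simp only: c_def times_complex.sel Re_complex_of_real Im_complex_of_real)
  have nz: "h z + of_real b \<noteq> 0" if "Re z > 0" for z
    using pos[OF that] b by (auto simp: complex_eq_iff)
  have sa: "s + of_real a \<noteq> 0"
    using s a by (auto simp: complex_eq_iff)
  define \<xi> where "\<xi> = (s - of_real a) / (s + of_real a)"
  have "norm (f \<xi>) \<le> norm \<xi>"
  proof (rule Schwarz_Lemma(1))
    have "c holomorphic_on ball 0 1"
      unfolding c_def by (intro holomorphic_intros) auto
    moreover have "c ` ball 0 1 \<subseteq> {z. Re z > 0}"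
      using Rc by auto
    ultimately have "(h \<circ> c) holomorphic_on ball 0 1"
      by (intro holomorphic_on_compose_gen[OF _ hol])
    thus "f holomorphic_on ball 0 1"
      unfolding f_def o_def using nz Rc by (intro holomorphic_intros) auto
    show "f 0 = 0" by (simp add: f_def c_def a)
    show "norm (f z) < 1" if "norm z < 1" for z
      using norm_diff_less_norm_add[OF pos[OF Rc[OF that]] b] nz[OF Rc[OF that]]
      by (simp add: f_def norm_divide)
    show "norm \<xi> < 1"
      using norm_diff_less_norm_add[OF s a(1)] sa by (simp add: \<xi>_def norm_divide)
  qed
  moreover have "c \<xi> = s"
  proof -
    have "1 + \<xi> = 2 * s / (s + of_real a)" "1 - \<xi> = 2 * of_real a / (s + of_real a)"
      using sa by (simp_all add: \<xi>_def field_simps)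
    thus ?thesis using sa a by (simp add: c_def)
  qed
  ultimately show ?thesis
    using nz[OF s] sa by (simp add: f_def \<xi>_def norm_divide field_simps)
qed

lemma schwarz_pick_half_plane:
  assumes hol: "h holomorphic_on {z. Re z > 0}"
    and pos: "\<And>z. Re z > 0 \<Longrightarrow> Re (h z) \<ge> 0"
    and a: "a > 0" "h (of_real a) = of_real b" and s: "Re s > 0"
  shows "norm (h s - of_real b) * norm (s + of_real a) \<le> norm (h s + of_real b) * norm (s - of_real a)"
proof (rule field_le_epsilon)
  fix e :: real
  assume e: "e > 0"
  define q where "q = norm (s - of_real a)"
  \<comment> \<open>Shifting \<open>h\<close> by \<open>d\<close> makes its real part strictly
    positive; this size keeps the resulting error \<open>2 * d * q\<close> below
    \<open>e\<close>.\<close>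
  define d where "d = e / (2 * (q + 1))"
  have q: "q \<ge> 0" by (simp add: q_def)
  have d: "d > 0" using e q by (simp add: d_def)
  have "norm ((h s + of_real d) - of_real (b + d)) * norm (s + of_real a) \<le>
      norm ((h s + of_real d) + of_real (b + d)) * norm (s - of_real a)"
    by (rule schwarz_pick_half_plane_strict[of "\<lambda>z. h z + of_real d"])
      (use a s d pos in \<open>auto intro!: holomorphic_intros hol add_nonneg_pos\<close>)
  also have "norm ((h s + of_real d) + of_real (b + d)) \<le> norm (h s + of_real b) + 2 * d"
    using norm_triangle_ineq[of "h s + of_real b" "of_real (2 * d)"] d
    by (simp add: norm_mult algebra_simps)
  hence "norm ((h s + of_real d) + of_real (b + d)) * norm (s - of_real a) \<le>
      (norm (h s + of_real b) + 2 * d) * norm (s - of_real a)"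
    by (rule mult_right_mono) simp
  also have "\<dots> \<le> norm (h s + of_real b) * norm (s - of_real a) + e"
  proof -
    have "2 * d * q = e * (q / (q + 1))"
      using q by (simp add: d_def divide_simps)
    also have "\<dots> \<le> e * 1"
      using e q by (intro mult_left_mono) auto
    finally show ?thesis by (simp add: q_def algebra_simps)
  qed
  finally show "norm (h s - of_real b) * norm (s + of_real a) \<le>
      norm (h s + of_real b) * norm (s - of_real a) + e"
    by simp
qed

text \<open>A positive real function does not increase the modulus of the argument: the hyperbolic
  distance of \<^term>\<open>h s\<close> to the positive axis is at most that of \<^term>\<open>s\<close>.\<close>

lemma positive_real_sector:
  assumes hol: "h holomorphic_on {z. Re z > 0}"
    and pos: "\<And>z. Re z > 0 \<Longrightarrow> Re (h z) \<ge> 0"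
    and real: "Im (h (of_real (norm s))) = 0" and s: "Re s > 0"
  shows "norm (h s) * Re s \<le> norm s * Re (h s)"
proof -
  \<comment> \<open>Among the points of the positive axis, \<open>norm s\<close> is hyperbolically
    closest to \<open>s\<close>, so it gives the sharpest comparison.\<close>
  define a where "a = norm s"
  define b where "b = Re (h (of_real a))"
  define N where "N = norm (h s)"
  have a: "a > 0" using s by (auto simp: a_def)
  have hb: "h (of_real a) = of_real b"
    using real by (simp add: complex_eq_iff a_def b_def)
  have b: "b \<ge> 0" using pos[of "of_real a"] a by (simp add: b_def)
  have eq: "(norm (z + of_real c))\<^sup>2 = (norm z)\<^sup>2 + c\<^sup>2 + 2 * c * Re z"
    "(norm (z - of_real c))\<^sup>2 = (norm z)\<^sup>2 + c\<^sup>2 - 2 * c * Re z" for z c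
    unfolding cmod_power2 by (simp_all add: power2_eq_square algebra_simps)
  have "(norm (h s - of_real b) * norm (s + of_real a))\<^sup>2 \<le>
      (norm (h s + of_real b) * norm (s - of_real a))\<^sup>2"
    using schwarz_pick_half_plane[OF hol pos a hb s] by (intro power_mono) auto
  hence "(N\<^sup>2 + b\<^sup>2 - 2 * b * Re (h s)) * (a\<^sup>2 + a\<^sup>2 + 2 * a * Re s) \<le>
      (N\<^sup>2 + b\<^sup>2 + 2 * b * Re (h s)) * (a\<^sup>2 + a\<^sup>2 - 2 * a * Re s)"
    unfolding power_mult_distrib eq by (simp add: a_def N_def)
  hence "(4 * a) * ((N\<^sup>2 + b\<^sup>2) * Re s) \<le> (4 * a) * (2 * b * Re (h s) * a)"
    by (simp add: power2_eq_square algebra_simps)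
  hence le: "(N\<^sup>2 + b\<^sup>2) * Re s \<le> 2 * b * Re (h s) * a"
    using a by (simp only: mult_le_cancel_left)
  show ?thesis
  proof (cases "b = 0")
    case True
    hence "N = 0" using le s by (simp add: mult_le_0_iff)
    thus ?thesis by (simp add: N_def)
  next
    case False
    \<comment> \<open>The value \<open>b\<close> at the base point is unknown; the
      arithmetic-geometric mean inequality removes it from \<open>le\<close>.\<close>
    have "2 * b * N * Re s \<le> (N\<^sup>2 + b\<^sup>2) * Re s"
      using s sum_squares_bound[of b N] by (intro mult_right_mono) auto
    also note le
    finally have "(2 * b) * (N * Re s) \<le> (2 * b) * (a * Re (h s))"
      by (simp add: algebra_simps)
    thus ?thesis using False b by (simp add: mult_le_cancel_left N_def a_def)
  qed
qed

lemma positive_real_Im_mult_cnj: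
  assumes hol: "h holomorphic_on {z. Re z > 0}"
    and pos: "\<And>z. Re z > 0 \<Longrightarrow> Re (h z) \<ge> 0"
    and real: "Im (h (of_real (norm s))) = 0" and s: "Re s > 0" "Im s > 0"
  shows "Im (h s * cnj s) \<le> 0"
proof -
  have "(norm (h s) * Re s)\<^sup>2 \<le> (norm s * Re (h s))\<^sup>2"
    using positive_real_sector[OF assms(1-4)] s by (intro power_mono) auto
  hence "(Im (h s) * Re s)\<^sup>2 \<le> (Re (h s) * Im s)\<^sup>2"
    unfolding power_mult_distrib cmod_power2 by (simp add: algebra_simps)
  hence "Im (h s) * Re s \<le> Re (h s) * Im s"
    using pos[OF s(1)] s by (intro power2_le_imp_le[of "Im (h s) * Re s"]) auto
  thus ?thesis by (simp add: algebra_simps)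
qed

text \<open>Schwarz-Pick at the base point 1 gives
  \<open>norm (h s) * (p - q) \<le> b * (p + q)\<close>. Multiplication by \<open>p + q\<close>
  turns the left factor into \<open>p\<^sup>2 - q\<^sup>2 = 4 * Re s\<close>, and the 4 cancels
  against the bound \<open>2 * (norm s + 1)\<close> for \<open>p + q\<close>, used twice.\<close>

lemma positive_real_growth:
  assumes hol: "h holomorphic_on {z. Re z > 0}"
    and pos: "\<And>z. Re z > 0 \<Longrightarrow> Re (h z) \<ge> 0"
    and b: "h 1 = of_real b" and s: "Re s > 0"
  shows "norm (h s) * Re s \<le> b * (norm s + 1)\<^sup>2"
proof -
  define p q where "p = norm (s + 1)" and "q = norm (s - 1)"
  have b0: "b \<ge> 0" using pos[of 1] b by simp
  have pq: "p \<le> norm s + 1" "q \<le> norm s + 1" "p \<ge> 0" "q \<ge> 0"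
    using norm_triangle_ineq[of s 1] norm_triangle_ineq4[of s 1] by (simp_all add: p_def q_def)
  have "norm (h s - of_real b) * p \<le> norm (h s + of_real b) * q"
    using schwarz_pick_half_plane[OF hol pos, of 1 b s] b s by (simp add: p_def q_def)
  moreover have "(norm (h s) - b) * p \<le> norm (h s - of_real b) * p"
    using norm_triangle_ineq2[of "h s" "of_real b"] b0 pq by (intro mult_right_mono) auto
  moreover have "norm (h s + of_real b) * q \<le> (norm (h s) + b) * q"
    using norm_triangle_ineq[of "h s" "of_real b"] b0 pq by (intro mult_right_mono) auto
  ultimately have "norm (h s) * (p - q) \<le> b * (p + q)"
    by (simp add: algebra_simps)
  hence "norm (h s) * (p - q) * (p + q) \<le> b * (p + q) * (p + q)"
    using pq by (intro mult_right_mono) auto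
  also have "\<dots> \<le> b * (2 * (norm s + 1)) * (2 * (norm s + 1))"
    using pq b0 by (intro mult_mono) auto
  also have "norm (h s) * (p - q) * (p + q) = norm (h s) * (p\<^sup>2 - q\<^sup>2)"
    by (simp add: power2_eq_square algebra_simps)
  also have "p\<^sup>2 - q\<^sup>2 = 4 * Re s"
    unfolding p_def q_def cmod_power2 by (simp add: power2_eq_square algebra_simps)
  finally show ?thesis by (simp add: power2_eq_square algebra_simps)
qed

section \<open>Matrix polynomials\<close>

lemma meval_add: "meval (F + G) z = meval F z + meval G z"
  by (simp add: meval_def vec_eq_iff)

lemma tendsto_meval [tendsto_intros]:
  assumes "(f \<longlongrightarrow> a) Q"
  shows "((\<lambda>x. meval F (f x)) \<longlongrightarrow> meval F a) Q"
  unfolding tendsto_vec_iff meval_def by (auto intro!: tendsto_intros assms)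

lemma holomorphic_meval:
  assumes "f holomorphic_on S"
  shows "(\<lambda>z. meval F (f z) $ i $ j) holomorphic_on S"
  unfolding meval_def by (simp add: poly_holomorphic_on[OF assms])

lemma poly_div_power_tendsto:
  fixes p :: "complex poly"
  assumes "degree p \<le> d"
  shows "((\<lambda>z. inverse (z ^ d) * poly p z) \<longlongrightarrow> coeff p d) at_infinity"
proof (cases "degree p = d")
  case True
  thus ?thesis using poly_divide_tendsto_aux[of p] by (simp add: field_simps)
next
  case False
  thus ?thesis
    using poly_divide_tendsto_0_at_infinity[of p "monom 1 d"] assms
    by (simp add: degree_monom_eq poly_monom coeff_eq_0 field_simps)
qed

lemma degree_le_iff_mcoeff: "(\<forall>i j. degree (F $ i $ j) \<le> d) \<longleftrightarrow> (\<forall>k>d. mcoeff F k = 0)"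
proof safe
  fix i j
  assume "\<forall>k>d. mcoeff F k = 0"
  hence "coeff (F $ i $ j) k = 0" if "k > d" for k
    using that by (auto simp: mcoeff_def vec_eq_iff)
  thus "degree (F $ i $ j) \<le> d" by (intro degree_le) auto
next
  fix k
  assume "\<forall>i j. degree (F $ i $ j) \<le> d" "k > d"
  thus "mcoeff F k = 0"
    by (simp add: mcoeff_def vec_eq_iff coeff_eq_0 le_less_trans[of _ d k])
qed

text \<open>The bound \<open>d\<close> need not be attained, so the limit may be zero; this occurs
  for the even part when the degree of \<open>F\<close> is odd.\<close>

lemma meval_tendsto_mcoeff:
  assumes "\<And>k. k > d \<Longrightarrow> mcoeff F k = 0"
  shows "((\<lambda>z. mat (inverse (z ^ d)) ** meval F z) \<longlongrightarrow> mcoeff F d) at_infinity"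
proof -
  have "degree (F $ i $ j) \<le> d" for i j
    using degree_le_iff_mcoeff[of F d] assms by blast
  hence "((\<lambda>z. inverse (z ^ d) * poly (F $ i $ j) z) \<longlongrightarrow> coeff (F $ i $ j) d) at_infinity" for i j
    by (rule poly_div_power_tendsto)
  moreover have "(mat (inverse (z ^ d)) ** meval F z) $ i $ j = inverse (z ^ d) * poly (F $ i $ j) z" for i j z
    by (simp add: matrix_matrix_mult_def mat_def meval_def if_distrib if_distribR cong: if_cong)
  ultimately show ?thesis
    unfolding tendsto_vec_iff by (simp add: mcoeff_def)
qed

lemma det_mcoeff_neq_0_imp_regular:
  assumes "\<And>k. k > d \<Longrightarrow> mcoeff P k = 0" "det (mcoeff P d) \<noteq> 0"
  shows "det P \<noteq> 0"
proof
  assume "det P = 0"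
  hence "det (meval P z) = 0" for z by (simp add: det_meval)
  hence "((\<lambda>z::complex. 0) \<longlongrightarrow> det (mcoeff P d)) at_infinity"
    using tendsto_det[OF meval_tendsto_mcoeff[OF assms(1)]] by (simp add: det_mul)
  thus False
    using assms(2) tendsto_unique[OF _ tendsto_const] by (metis trivial_limit_at_infinity)
qed

lemma mcoeff_gt_mdegree: "k > mdegree F \<Longrightarrow> mcoeff F k = 0"
proof -
  have "finite {degree (F $ i $ j) | i j. True}"
    by (rule finite_subset[of _ "(\<lambda>(i, j). degree (F $ i $ j)) ` UNIV"]) auto
  hence "\<forall>i j. degree (F $ i $ j) \<le> mdegree F"
    unfolding mdegree_def by (intro allI Max_ge) auto
  thus "k > mdegree F \<Longrightarrow> mcoeff F k = 0"
    by (simp add: degree_le_iff_mcoeff)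
qed

lemma meval_even_odd:
  "meval F z *v x = meval (even_part F) (z\<^sup>2) *v x + z *s (meval (odd_part F) (z\<^sup>2) *v x)"
proof -
  have "meval F z = meval (even_part F) (z\<^sup>2) + mat z ** meval (odd_part F) (z\<^sup>2)"
    using even_odd_part_unique[of F "even_part F" "odd_part F"] by simp
  thus ?thesis
    by (simp add: matrix_vector_mult_add_rdistrib matrix_vector_mul_assoc[symmetric] mat_vector_mult)
qed

lemma meval_even_odd_uminus:
  "meval F (- z) *v x = meval (even_part F) (z\<^sup>2) *v x - z *s (meval (odd_part F) (z\<^sup>2) *v x)"
  by (simp add: meval_even_odd[of F "- z"])

text \<open>Entrywise division by the linear factor. The value of \<open>N\<close> at
  \<open>c\<close> is the derivative of \<open>P\<close> at \<open>c\<close>, so \<open>N\<close>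
  encodes Jordan chains of \<open>P\<close> without differentiating.\<close>

lemma meval_factor:
  obtains N where "\<And>w x. meval P w *v x = meval P c *v x + (w - c) *s (meval N w *v x)"
proof
  fix w x
  have *: "poly p w = poly p c + (w - c) * poly (synthetic_div p c) w" for p :: "complex poly"
    using arg_cong[OF synthetic_div_correct'[of c p], of "\<lambda>q. poly q w"] by (simp add: algebra_simps)
  have "meval P w $ i $ j =
      (meval P c + mat (w - c) ** meval (map_matrix (\<lambda>q. synthetic_div q c) P) w) $ i $ j" for i j
    using *[of "P $ i $ j"]
    by (simp add: meval_def matrix_matrix_mult_def mat_def if_distrib if_distribR cong: if_cong)
  hence "meval P w = meval P c + mat (w - c) ** meval (map_matrix (\<lambda>q. synthetic_div q c) P) w"
    by (simp add: vec_eq_iff)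
  thus "meval P w *v x = meval P c *v x + (w - c) *s (meval (map_matrix (\<lambda>q. synthetic_div q c) P) w *v x)"
    by (simp add: matrix_vector_mult_add_rdistrib matrix_vector_mul_assoc[symmetric] mat_vector_mult)
qed

subsection \<open>Multiplicity and nullity\<close>

text \<open>The hypothesis \<open>chain\<close> excludes Jordan chains of length two at
  \<open>c\<close>. Multiply \<open>P\<close> by a constant basis matrix whose columns extend a
  basis of the kernel of \<open>meval P c\<close>. Each kernel column is divisible by the linear
  factor at \<open>c\<close>; extracting these factors yields the power given by the nullity and
  leaves a matrix that is nonsingular at \<open>c\<close>.\<close>

lemma order_det_eq_nullity:
  fixes P N :: "complex poly^'n^'n"
  assumes P: "det P \<noteq> 0"
    and N: "\<And>w x. meval P w *v x = meval P c *v x + (w - c) *s (meval N w *v x)"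
    and chain: "\<And>u v. meval P c *v u = 0 \<Longrightarrow> meval N c *v u + meval P c *v v = 0 \<Longrightarrow> u = 0"
  shows "order c (det P) = nullity (meval P c)"
proof -
  define K where "K = {v. meval P c *v v = 0}"
  obtain B where B: "B \<subseteq> K" "vec.independent B" "K \<subseteq> vec.span B" "card B = vec.dim K"
    by (rule vec.basis_exists[of K])
  obtain B' where B': "B \<subseteq> B'" "vec.independent B'" "UNIV \<subseteq> vec.span B'"
    by (rule vec.maximal_independent_subset_extend[OF subset_UNIV B(2)])
  have fin: "finite B'" by (rule vec.finiteI_independent[OF B'(2)])
  have "card B' = CARD('n)"
    using vec.basis_card_eq_dim[of B' UNIV] B' vec_dim_card[where 'a = complex and 'n = 'n] by simp
  then obtain b where b: "bij_betw b (UNIV :: 'n set) B'"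
    using finite_same_card_bij[of "UNIV :: 'n set" B'] fin by (metis finite)
  define J where "J = {j. b j \<in> B}"
  have "bij_betw b J B"
    using b B'(1) unfolding bij_betw_def J_def inj_on_def by blast
  hence cardJ: "card J = vec.dim K" using B(4) by (simp add: bij_betw_same_card)
  define V :: "complex^'n^'n" where "V = (\<chi> i j. b j $ i)"
  have V: "V *v x = (\<Sum>j\<in>UNIV. x $ j *s b j)" for x
    by (simp add: V_def matrix_vector_mult_def vec_eq_iff mult.commute)
  have V0: "x = 0" if "V *v x = 0" for x
  proof -
    define t where "t = (\<lambda>v. x $ inv_into UNIV b v)"
    have t: "t (b j) = x $ j" for j
      using b by (simp add: t_def bij_betw_def)
    have "(\<Sum>v\<in>B'. t v *s v) = 0"
      using that sum.reindex_bij_betw[OF b, of "\<lambda>v. t v *s v"] by (simp add: V t)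
    hence "t v = 0" if "v \<in> B'" for v
      using vec.independentD[OF B'(2) fin order_refl] that by blast
    moreover have "b j \<in> B'" for j using b by (auto simp: bij_betw_def)
    ultimately show ?thesis using t by (simp add: vec_eq_iff)
  qed
  define Vp :: "complex poly^'n^'n" where "Vp = map_matrix (\<lambda>a. [:a:]) V"
  have Vp: "meval Vp w = V" for w
    by (simp add: Vp_def meval_def vec_eq_iff)
  have detV: "det V \<noteq> 0" using V0 det_eq_0_iff_kernel[of V] by blast
  hence ordV: "order c (det Vp) = 0" "det Vp \<noteq> 0"
    using det_meval[of Vp c] by (simp_all add: Vp order_0I) auto
  \<comment> \<open>The product \<open>P ** Vp\<close> with one linear factor removed from each
    column in \<open>J\<close>; by \<open>N\<close> the quotient is the corresponding column of
    \<open>N ** Vp\<close>.\<close>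
  define M :: "complex poly^'n^'n"
    where "M = (\<chi> i j. if j \<in> J then (N ** Vp) $ i $ j else (P ** Vp) $ i $ j)"
  define d where "d = (\<lambda>j. if j \<in> J then [:-c, 1:] else 1)"
  define Dg :: "complex poly^'n^'n" where "Dg = (\<chi> i j. if i = j then d j else 0)"
  have ent: "poly ((Q ** Vp) $ i $ j) w = (meval Q w *v b j) $ i" for Q i j w
    by (simp add: matrix_matrix_mult_def matrix_vector_mult_def poly_sum meval_def Vp_def V_def mult.commute)
  have "(P ** Vp) $ i $ j = (M ** Dg) $ i $ j" for i j
  proof -
    have *: "(M ** Dg) $ i $ j = M $ i $ j * d j"
      by (simp add: matrix_matrix_mult_def Dg_def if_distrib cong: if_cong)
    show ?thesis
    proof (cases "j \<in> J")
      case True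
      hence "meval P c *v b j = 0" using B(1) by (auto simp: J_def K_def)
      hence "poly ((P ** Vp) $ i $ j) w = poly ([:-c, 1:] * (N ** Vp) $ i $ j) w" for w
        unfolding poly_mult ent by (subst N) (simp add: algebra_simps)
      thus ?thesis unfolding * using True by (simp add: M_def d_def poly_eq_poly_eq_iff[symmetric] fun_eq_iff)
    next
      case False
      thus ?thesis unfolding * by (simp add: M_def d_def)
    qed
  qed
  hence "P ** Vp = M ** Dg" by (simp add: vec_eq_iff)
  hence "det P * det Vp = det M * det Dg" by (metis det_mul)
  moreover have "det Dg = [:-c, 1:] ^ card J"
    by (subst det_diagonal) (simp_all add: Dg_def d_def prod.If_cases)
  ultimately have eq: "det P * det Vp = det M * [:-c, 1:] ^ card J" by simp
  \<comment> \<open>Nonsingularity of \<open>M\<close> at \<open>c\<close>. The part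
    \<open>x1\<close> of \<open>x\<close> on \<open>J\<close> gives a kernel vector
    \<open>V *v x1\<close>, and with \<open>V *v x2\<close> it would form a Jordan chain, so it
    vanishes.\<close>
  have "x = 0" if x: "meval M c *v x = 0" for x
  proof -
    define x1 x2 where "x1 = (\<chi> j. if j \<in> J then x $ j else 0)"
      and "x2 = (\<chi> j. if j \<in> J then 0 else x $ j)"
    have "meval M c $ i $ j = (if j \<in> J then (meval N c ** V) $ i $ j else (meval P c ** V) $ i $ j)" for i j
    proof -
      have "meval M c $ i $ j = (if j \<in> J then meval (N ** Vp) c $ i $ j else meval (P ** Vp) c $ i $ j)"
        by (simp add: meval_def M_def)
      thus ?thesis by (simp only: meval_mult Vp)
    qed
    hence "meval M c $ i $ j * x $ j =
        (meval N c ** V) $ i $ j * x1 $ j + (meval P c ** V) $ i $ j * x2 $ j" for i j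
      by (simp add: x1_def x2_def)
    hence "meval M c *v x = (meval N c ** V) *v x1 + (meval P c ** V) *v x2"
      by (simp add: vec_eq_iff matrix_vector_mult_def sum.distrib)
    hence eq0: "meval N c *v (V *v x1) + meval P c *v (V *v x2) = 0"
      using x by (simp add: matrix_vector_mul_assoc)
    have "meval P c *v (V *v x1) = 0"
    proof -
      have "x1 $ j *s (meval P c *v b j) = 0" for j
        using B(1) by (auto simp: x1_def J_def K_def)
      thus ?thesis
        unfolding V vec.linear_sum[OF matrix_vector_mul_linear_gen] scale_matrix_vector_mult
        by (intro sum.neutral ballI)
    qed
    hence "V *v x1 = 0" using chain eq0 by blast
    hence x1: "x1 = 0" by (rule V0)
    \<comment> \<open>\<open>V *v x2\<close> involves only basis vectors outside \<open>B\<close>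
      but now lies in the span of \<open>B\<close>; uniqueness of coordinates, through
      \<open>y\<close>, leaves zero.\<close>
    hence "V *v x2 \<in> K" using eq0 by (simp add: K_def)
    hence "V *v x2 \<in> vec.span B" using B(3) by blast
    then obtain t where t: "V *v x2 = (\<Sum>v\<in>B. t v *s v)"
      using finite_subset[OF B'(1) fin] by (auto simp: vec.span_finite)
    define y where "y = (\<chi> j. if j \<in> J then t (b j) else 0)"
    have "V *v y = (\<Sum>j\<in>J. t (b j) *s b j)"
      by (simp add: V y_def sum.If_cases if_distrib[of "\<lambda>a. a *s _"] cong: if_cong)
    also have "\<dots> = V *v x2"
      unfolding t by (rule sum.reindex_bij_betw[OF \<open>bij_betw b J B\<close>])
    finally have "V *v (y - x2) = 0" by (simp add: matrix_vector_mult_diff_distrib)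
    hence "y - x2 = 0" by (rule V0)
    hence y: "y $ j = x2 $ j" for j by (simp add: vec_eq_iff)
    have "x $ j = 0" for j
    proof (cases "j \<in> J")
      case True
      thus ?thesis using arg_cong[OF x1, of "\<lambda>v. v $ j"] by (simp add: x1_def)
    next
      case False
      thus ?thesis using y[of j] by (simp add: x2_def y_def)
    qed
    thus ?thesis by (simp add: vec_eq_iff)
  qed
  hence "poly (det M) c \<noteq> 0"
    using det_eq_0_iff_kernel[of "meval M c"] by (auto simp: det_meval)
  hence "order c (det M) = 0" "det M \<noteq> 0" by (auto intro: order_0I)
  moreover have "order c (det P) + order c (det Vp) = order c (det M) + order c ([:-c, 1:] ^ card J)"
  proof -
    have "det P * det Vp \<noteq> 0" using P ordV(2) by simp
    thus ?thesis using order_mult[of "det P" "det Vp" c]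
      order_mult[of "det M" "[:-c, 1:] ^ card J" c] eq by simp
  qed
  ultimately show ?thesis
    using ordV cardJ by (simp add: order_power_n_n nullity_def K_def)
qed

subsection \<open>Greatest right common divisors\<close>

text \<open>Cramer's rule for rows, cleared of denominators: it is proved over the fraction field
  and pulled back along the injective map \<open>to_fract\<close>.\<close>

lemma cramer_rows_poly:
  fixes D :: "complex poly^'n^'n"
  assumes "det D \<noteq> 0"
  shows "det D * g $ j = (\<Sum>i\<in>UNIV. det (\<chi> r. if r = i then g else D $ r) * D $ i $ j)"
proof -
  define A where "A = rmat_of_mpoly D"
  define g' where "g' = (\<chi> j. to_fract (g $ j))"
  have dA: "det A = to_fract (det D)" by (simp add: A_def det_rmat_of_mpoly)
  hence "det (transpose A) \<noteq> 0" using assms by simp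
  define x where "x = matrix_inv (transpose A) *v g'"
  have "transpose A *v x = g'"
    unfolding x_def by (rule matrix_inv_vector_mult) fact
  hence g': "(\<Sum>i\<in>UNIV. x $ i *s row i A) = g'"
    by (simp add: vec_eq_iff matrix_vector_mult_def transpose_def row_def mult.commute)
  have rep: "to_fract (det (\<chi> r. if r = k then g else D $ r)) = x $ k * det A" for k
  proof -
    have *: "rmat_of_mpoly (\<chi> r. if r = k then g else D $ r) = (\<chi> i. if i = k then g' else row i A)"
      by (simp add: rmat_of_mpoly_def vec_eq_iff g'_def A_def row_def)
    have "to_fract (det (\<chi> r. if r = k then g else D $ r)) =
        det (\<chi> i. if i = k then (\<Sum>i\<in>UNIV. x $ i *s row i A) else row i A)"
      by (simp only: det_rmat_of_mpoly[symmetric] * g')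
    also have "\<dots> = x $ k * det A"
      by (rule cramer_lemma_transpose)
    finally show ?thesis .
  qed
  have s: "to_fract (sum f X) = (\<Sum>x\<in>X. to_fract (f x))" for f :: "'n \<Rightarrow> complex poly" and X
    by (induction X rule: infinite_finite_induct) auto
  have "to_fract (\<Sum>i\<in>UNIV. det (\<chi> r. if r = i then g else D $ r) * D $ i $ j) =
      (\<Sum>i\<in>UNIV. x $ i * det A * A $ i $ j)"
    by (simp add: s rep) (simp add: A_def rmat_of_mpoly_def)
  also have "\<dots> = det A * (\<Sum>i\<in>UNIV. x $ i *s row i A) $ j"
    by (simp add: sum_distrib_left row_def mult_ac)
  also have "\<dots> = to_fract (det D * g $ j)"
    unfolding g' by (simp add: dA g'_def)
  finally show ?thesis by (simp only: to_fract_eq_iff)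
qed

text \<open>By multilinearity, subtracting a multiple of the replaced row is a Euclidean division
  step on the Cramer determinant with divisor \<open>det D\<close>.\<close>

lemma det_replace_row_diff:
  fixes D :: "'a::comm_ring_1^'n^'n"
  shows "det (\<chi> r. if r = i then g - q *s D $ i else D $ r) =
    det (\<chi> r. if r = i then g else D $ r) - q * det D"
proof -
  have "det (\<chi> r. if r = i then g + (- q) *s D $ i else D $ r) =
      det (\<chi> r. if r = i then g else D $ r) + (- q) * det (\<chi> r. if r = i then D $ i else D $ r)"
    unfolding det_row_mul[of i "- q" "\<lambda>_. D $ i" "\<lambda>r. D $ r", symmetric]
    by (rule det_row_add[of i "\<lambda>_. g" "\<lambda>_. (- q) *s D $ i" "\<lambda>r. D $ r"])
  moreover have "(\<chi> r. if r = i then D $ i else D $ r) = D"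
    by (simp add: vec_eq_iff)
  moreover have "g + (- q) *s D $ i = g - q *s D $ i"
    by (simp add: vec_eq_iff)
  ultimately show ?thesis by (simp only: mult_minus_left diff_conv_add_uminus)
qed

lemma matrix_mult_row: "(A ** B) $ i = A $ i v* B"
  for B :: "'a::comm_semiring_1^'n^'m"
  by (simp add: vec_eq_iff vector_matrix_mult_def matrix_matrix_mult_def mult.commute)

lemma matrix_matrix_mult_add_rdistrib: "(A + B) ** C = A ** C + B ** C"
  by (simp add: vec_eq_iff matrix_matrix_mult_def algebra_simps sum.distrib)

text \<open>Among the nonsingular matrices with rows in the module generated by the rows of the two
  given matrices, one with determinant of least degree is a greatest common divisor: if the
  Cramer determinants of a row are not divisible by that determinant, division with remainder
  produces a determinant of smaller degree.\<close>

lemma grcd_bezout: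
  fixes E P :: "complex poly^'n^'n"
  assumes P: "det P \<noteq> 0"
  obtains D U W where "is_grcd D E P" "D = U ** E + W ** P"
proof -
  define N where "N = {g. \<exists>a b. g = a v* E + b v* P}"
  have NE: "E $ i \<in> N" for i
  proof -
    have "E $ i = (mat 1 :: complex poly^'n^'n) $ i v* E + 0 v* P"
      using matrix_mult_row[of "mat 1" E i] by simp
    thus ?thesis unfolding N_def by blast
  qed
  have NP: "P $ i \<in> N" for i
  proof -
    have "P $ i = 0 v* E + (mat 1 :: complex poly^'n^'n) $ i v* P"
      using matrix_mult_row[of "mat 1" P i] by simp
    thus ?thesis unfolding N_def by blast
  qed
  have Ndiff: "g - q *s h \<in> N" if "g \<in> N" "h \<in> N" for g h q
  proof -
    from that obtain a b a' b' where "g = a v* E + b v* P" "h = a' v* E + b' v* P"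
      unfolding N_def by blast
    hence "g - q *s h = (a - q *s a') v* E + (b - q *s b') v* P"
      by (simp add: vec_eq_iff vector_matrix_mult_def algebra_simps sum.distrib
          sum_subtractf sum_distrib_left)
    thus ?thesis unfolding N_def by blast
  qed
  obtain D :: "complex poly^'n^'n" where D: "det D \<noteq> 0" "\<And>i. D $ i \<in> N"
    and minD: "\<And>D' :: complex poly^'n^'n. det D' \<noteq> 0 \<Longrightarrow> (\<And>i. D' $ i \<in> N) \<Longrightarrow> degree (det D) \<le> degree (det D')"
    using ex_has_least_nat[of "\<lambda>D. det D \<noteq> 0 \<and> (\<forall>i. D $ i \<in> N)" P "\<lambda>D. degree (det D)"] P NP
    by blast
  have "\<exists>C. G = C ** D" if G: "\<And>i. G $ i \<in> N" for G :: "complex poly^'n^'n"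
  proof -
    define f where "f = (\<lambda>k i. det (\<chi> r. if r = i then G $ k else D $ r))"
    have dvd: "det D dvd f k i" for k i
    proof (rule ccontr)
      assume "\<not> det D dvd f k i"
      hence ne: "f k i mod det D \<noteq> 0" by (simp add: dvd_eq_mod_eq_0)
      define D' where "D' = (\<chi> r. if r = i then G $ k - (f k i div det D) *s D $ i else D $ r)"
      have "det D' = f k i - f k i div det D * det D"
        unfolding D'_def f_def by (rule det_replace_row_diff)
      hence det': "det D' = f k i mod det D" by (simp add: minus_div_mult_eq_mod)
      have "D' $ r \<in> N" for r
        using Ndiff[OF G[of k] D(2)[of i]] D(2) by (simp add: D'_def)
      hence "degree (det D) \<le> degree (f k i mod det D)"
        using minD[of D'] ne by (simp add: det')
      moreover have "degree (f k i mod det D) < degree (det D)"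
        using degree_mod_less[OF D(1), of "f k i"] ne by blast
      ultimately show False by simp
    qed
    define C where "C = (\<chi> k i. f k i div det D)"
    have "det D * G $ k $ j = det D * (C ** D) $ k $ j" for k j
    proof -
      have "det D * G $ k $ j = (\<Sum>i\<in>UNIV. f k i * D $ i $ j)"
        unfolding f_def by (rule cramer_rows_poly[OF D(1)])
      also have "\<dots> = (\<Sum>i\<in>UNIV. det D * (C $ k $ i * D $ i $ j))"
        using dvd by (intro sum.cong refl) (simp add: C_def mult.assoc[symmetric])
      finally show ?thesis by (simp add: matrix_matrix_mult_def sum_distrib_left)
    qed
    hence "G = C ** D" using D(1) by (simp add: vec_eq_iff)
    thus ?thesis by blast
  qed
  hence div: "right_common_divisor D E P"
    using NE NP by (auto simp: right_common_divisor_def right_divisor_def)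
  have "\<forall>i. \<exists>a b. D $ i = a v* E + b v* P" using D(2) by (simp add: N_def)
  then obtain a b where ab: "\<And>i. D $ i = a i v* E + b i v* P" by metis
  define U W where "U = (\<chi> i. a i)" and "W = (\<chi> i. b i)"
  have "D $ i = (U ** E + W ** P) $ i" for i
    using ab[of i] by (simp add: matrix_mult_row U_def W_def)
  hence D_eq: "D = U ** E + W ** P" by (simp add: vec_eq_iff)
  have "right_divisor D' D" if "right_common_divisor D' E P" for D'
  proof -
    from that obtain C1 C2 where "E = C1 ** D'" "P = C2 ** D'"
      by (auto simp: right_common_divisor_def right_divisor_def)
    hence "D = (U ** C1 + W ** C2) ** D'"
      by (simp add: D_eq matrix_mul_assoc matrix_matrix_mult_add_rdistrib)
    thus ?thesis by (auto simp: right_divisor_def)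
  qed
  with div D_eq that show ?thesis by (auto simp: is_grcd_def)
qed

text \<open>A common kernel vector is annihilated by every combination
  \<open>U ** E + W ** P\<close>, hence by the divisor that the Bezout identity provides.
  Conversely, a kernel vector of a common right divisor is a common kernel vector.\<close>

lemma right_coprime_iff_kernel:
  assumes P: "det P \<noteq> 0"
  shows "right_coprime E P \<longleftrightarrow> (\<forall>w v. meval E w *v v = 0 \<longrightarrow> meval P w *v v = 0 \<longrightarrow> v = 0)"
proof safe
  fix w v
  assume "right_coprime E P" and v: "meval E w *v v = 0" "meval P w *v v = 0"
  obtain D U W where D: "is_grcd D E P" "D = U ** E + W ** P"
    using grcd_bezout[OF P] .
  have "det (meval D w) \<noteq> 0"
    using \<open>right_coprime E P\<close> D(1) by (simp add: right_coprime_def munimodular_def)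
  moreover have "meval D w *v v = 0"
    unfolding D(2) meval_add meval_mult
    by (simp add: matrix_vector_mult_add_rdistrib matrix_vector_mul_assoc[symmetric] v)
  ultimately show "v = 0" using det_eq_0_iff_kernel by blast
next
  assume *: "\<forall>w v. meval E w *v v = 0 \<longrightarrow> meval P w *v v = 0 \<longrightarrow> v = 0"
  show "right_coprime E P"
    unfolding right_coprime_def munimodular_def
  proof (intro allI impI notI)
    fix D w
    assume "is_grcd D E P" "det (meval D w) = 0"
    then obtain C1 C2 v where "E = C1 ** D" "P = C2 ** D" "v \<noteq> 0" "meval D w *v v = 0"
      by (auto simp: is_grcd_def right_common_divisor_def right_divisor_def det_eq_0_iff_kernel)
    thus False
      using *[rule_format, of w v] by (simp add: meval_mult matrix_vector_mul_assoc[symmetric])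
  qed
qed

section \<open>The rational matrix function\<close>

lemma det_mat_mult_neq_0:
  fixes A :: "'a::field^'n^'n"
  assumes "c \<noteq> 0" "det A \<noteq> 0"
  shows "det (mat c ** A) \<noteq> 0"
  using assms by (simp add: det_mul det_diagonal mat_def)

lemma matrix_vector_mult_uminus_left: "(- A) *v x = - (A *v x)" for A :: "'a::ring_1^'n^'m"
  by (simp add: vec_eq_iff matrix_vector_mult_def sum_negf)

text \<open>An inverse-free form of the definition: vectors are written as \<open>w\<close> times
  the odd part applied to \<open>x\<close>, which covers the whole space when the odd part is
  nonsingular.\<close>

lemma Rtilde_mult_vec:
  assumes "w \<noteq> 0" "det (meval (odd_part F) w) \<noteq> 0"
  shows "rmat_eval (Rtilde F) w *v (w *s (meval (odd_part F) w *v x)) = - (meval (even_part F) w *v x)"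
proof -
  have "matrix_inv (mat w ** meval (odd_part F) w) *v ((mat w ** meval (odd_part F) w) *v x) = x"
    using assms by (intro matrix_inv_vector_mult det_mat_mult_neq_0)
  moreover have "w *s (meval (odd_part F) w *v x) = (mat w ** meval (odd_part F) w) *v x"
    by (simp add: matrix_vector_mul_assoc[symmetric] mat_vector_mult)
  ultimately show ?thesis
    using rmat_eval_Rtilde(2)[of w F] assms
    by (simp add: mzeros_def matrix_vector_mul_assoc[symmetric] matrix_vector_mult_uminus_left)
qed

lemma ctranspose_Rtilde_cnj:
  assumes "rmat_self_adjoint (Rtilde F)" "w \<noteq> 0" "det (meval (odd_part F) w) \<noteq> 0"
  shows "ctranspose (rmat_eval (Rtilde F) (cnj w)) = rmat_eval (Rtilde F) w"
  using assms rmat_eval_Rtilde(1)[of w F] by (simp add: rmat_self_adjoint_def mzeros_def)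

lemma eventually_at_not_in_finite:
  fixes a :: "'a::t1_space"
  assumes "finite T"
  shows "eventually (\<lambda>x. x \<notin> T) (at a)"
  using islimpt_finite[OF assms] islimpt_iff_eventually by blast

lemma finite_zeros_of_real:
  fixes p :: "complex poly"
  assumes "p \<noteq> 0"
  shows "finite {t :: real. poly p (of_real t) = 0}"
  using finite_vimageI[OF poly_roots_finite[OF assms], of complex_of_real]
  by (simp add: vimage_def inj_on_def)

text \<open>Away from 0 and the zeros of the odd part this is self-adjointness of
  \<open>Rtilde F\<close> at a real point. Both sides are continuous in \<open>t\<close> and the
  excluded points are finitely many, so the identity extends to them.\<close>

lemma hermitian_even_odd:
  fixes t :: real
  assumes sa: "rmat_self_adjoint (Rtilde F)" and reg: "mregular (odd_part F)"
  shows "hip (meval (odd_part F) (of_real t) *v x) (meval (even_part F) (of_real t) *v y) =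
    hip (meval (even_part F) (of_real t) *v x) (meval (odd_part F) (of_real t) *v y)"
proof -
  define g where "g = (\<lambda>t::real. hip (meval (odd_part F) (of_real t) *v x) (meval (even_part F) (of_real t) *v y) -
    hip (meval (even_part F) (of_real t) *v x) (meval (odd_part F) (of_real t) *v y))"
  have g0: "g s = 0" if "s \<noteq> 0" "poly (det (odd_part F)) (of_real s) \<noteq> 0" for s
  proof -
    have *: "(of_real s :: complex) \<noteq> 0" "det (meval (odd_part F) (of_real s)) \<noteq> 0"
      using that by (simp_all add: det_meval)
    define R x' y' where "R = rmat_eval (Rtilde F) (of_real s)"
      and "x' = of_real s *s (meval (odd_part F) (of_real s) *v x)"
      and "y' = of_real s *s (meval (odd_part F) (of_real s) *v y)"
    have "ctranspose R = R"
      using ctranspose_Rtilde_cnj[OF sa *] by (simp add: R_def)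
    hence "hip (R *v x') y' = hip x' (R *v y')"
      using hip_ctranspose[of R x' y'] by simp
    moreover have "R *v x' = - (meval (even_part F) (of_real s) *v x)"
      "R *v y' = - (meval (even_part F) (of_real s) *v y)"
      unfolding R_def x'_def y'_def by (rule Rtilde_mult_vec[OF *])+
    ultimately show ?thesis
      using that(1) by (simp add: g_def x'_def y'_def hip_minus hip_scale)
  qed
  have "finite (insert 0 {t :: real. poly (det (odd_part F)) (of_real t) = 0})"
    using reg finite_zeros_of_real by (simp add: mregular_def)
  from eventually_at_not_in_finite[OF this, of t]
  have "eventually (\<lambda>s. 0 = g s) (at t)"
    by eventually_elim (auto simp: g0)
  hence "(g \<longlongrightarrow> 0) (at t)"
    by (rule Lim_transform_eventually[OF tendsto_const])
  moreover have "(g \<longlongrightarrow> g t) (at t)"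
    unfolding g_def by (intro tendsto_intros)
  ultimately have "g t = 0"
    using tendsto_unique trivial_limit_at by blast
  thus ?thesis by (simp add: g_def)
qed

lemma matrix_inv_mat_mult:
  fixes A :: "complex^'n^'n"
  assumes "c \<noteq> 0" "det A \<noteq> 0"
  shows "matrix_inv (mat c ** A) *v x = inverse c *s (matrix_inv A *v x)"
proof -
  have "(mat c ** A) *v (inverse c *s (matrix_inv A *v x)) = x"
    using assms
    by (simp add: matrix_vector_mul_assoc[symmetric] mat_vector_mult scale_matrix_vector_mult
        matrix_inv_vector_mult)
  thus ?thesis
    using matrix_inv_vector_mult(2)[OF det_mat_mult_neq_0[OF assms]] by metis
qed

text \<open>The factor \<open>z\<close> in the denominator of \<open>Rtilde F\<close> balances the
  scaling exponents \<open>Suc d\<close> and \<open>d\<close> of the two parts.\<close>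

lemma Rtilde_tendsto:
  fixes F :: "complex poly^'n^'n"
  assumes E: "\<And>k. k > Suc d \<Longrightarrow> mcoeff (even_part F) k = 0"
    and Od: "\<And>k. k > d \<Longrightarrow> mcoeff (odd_part F) k = 0"
    and det: "det (mcoeff (odd_part F) d) \<noteq> 0"
  shows "(rmat_eval (Rtilde F) \<longlongrightarrow>
    - (mcoeff (even_part F) (Suc d) ** matrix_inv (mcoeff (odd_part F) d))) at_infinity"
proof -
  define f where "f = (\<lambda>z. mat (inverse (z ^ Suc d)) ** meval (even_part F) z)"
  define g where "g = (\<lambda>z. mat (inverse (z ^ d)) ** meval (odd_part F) z)"
  have g: "(g \<longlongrightarrow> mcoeff (odd_part F) d) at_infinity"
    unfolding g_def by (intro meval_tendsto_mcoeff Od)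
  have "((\<lambda>z. - (f z ** matrix_inv (g z))) \<longlongrightarrow>
    - (mcoeff (even_part F) (Suc d) ** matrix_inv (mcoeff (odd_part F) d))) at_infinity"
    unfolding f_def by (intro tendsto_intros g det meval_tendsto_mcoeff E)
  moreover have "eventually (\<lambda>z. - (f z ** matrix_inv (g z)) = rmat_eval (Rtilde F) z) at_infinity"
    using tendsto_imp_eventually_ne[OF tendsto_det[OF g] det] eventually_not_equal_at_infinity[of 0]
  proof eventually_elim
    case (elim z)
    have dz: "det (meval (odd_part F) z) \<noteq> 0"
      using elim(1) by (auto simp: g_def det_mul)
    have "- (f z ** matrix_inv (g z)) *v x = rmat_eval (Rtilde F) z *v x" for x
      using rmat_eval_Rtilde(2)[of z F] dz elim(2)
      by (simp add: f_def g_def mzeros_def matrix_vector_mult_uminus_left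
          matrix_vector_mul_assoc[symmetric] matrix_inv_mat_mult mat_vector_mult
          scale_matrix_vector_mult field_simps)
    thus ?case by (simp add: matrix_eq)
  qed
  ultimately show ?thesis by (rule Lim_transform_eventually)
qed

section \<open>Stable matrix polynomials\<close>

lemma norm_add_diff_power2:
  "(norm (x + y))\<^sup>2 - (norm (x - y))\<^sup>2 = 4 * Re (hip x y)" for x y :: "complex^'n"
  by (simp add: Re_hip power2_norm_eq_inner algebra_simps inner_commute)

text \<open>The setting of the necessity direction. Self-adjointness enters as the polynomial
  identity \<open>hermitian\<close>, which also holds at zeros of the odd part.\<close>

locale stable_mpoly =
  fixes F :: "complex poly^'n^'n" and n :: nat
  assumes monic: "mcoeff F n = mat 1" "\<And>k. k > n \<Longrightarrow> mcoeff F k = 0"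
    and stable: "\<And>z. Re z \<ge> 0 \<Longrightarrow> det (meval F z) \<noteq> 0"
    and regular: "det (odd_part F) \<noteq> 0"
    and hermitian: "\<And>(t::real) x y.
      hip (meval (odd_part F) (of_real t) *v x) (meval (even_part F) (of_real t) *v y) =
      hip (meval (even_part F) (of_real t) *v x) (meval (odd_part F) (of_real t) *v y)"
begin

abbreviation "Ev \<equiv> meval (even_part F)"
abbreviation "Od \<equiv> meval (odd_part F)"

section \<open>Consequences of stability and hermiticity\<close>

lemma kernel_F: "Re z \<ge> 0 \<Longrightarrow> meval F z *v x = 0 \<Longrightarrow> x = 0"
  using stable[of z] det_eq_0_iff_kernel[of "meval F z"] by blast

text \<open>On the imaginary axis \<open>z\<^sup>2\<close> is real, so the pairing \<open>c\<close>
  is real and \<open>z * c\<close> is imaginary: the cross terms in the two squared norms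
  vanish.\<close>

lemma norm_imaginary_axis:
  assumes "Re z = 0"
  shows "norm (meval F (- z) *v x) = norm (meval F z *v x)"
proof -
  define c where "c = hip (Ev (z\<^sup>2) *v x) (Od (z\<^sup>2) *v x)"
  have "z\<^sup>2 = of_real (- (Im z)\<^sup>2)"
    using assms by (simp add: complex_eq_iff power2_eq_square)
  hence "cnj c = c"
    using hermitian[of "- (Im z)\<^sup>2" x x] by (simp add: c_def cnj_hip)
  hence "Im c = 0" by (simp add: complex_eq_iff)
  hence "Re (z * c) = 0" using assms by simp
  hence "(norm (meval F z *v x))\<^sup>2 = (norm (meval F (- z) *v x))\<^sup>2"
    using norm_add_diff_power2[of "Ev (z\<^sup>2) *v x" "z *s (Od (z\<^sup>2) *v x)"]
    by (simp add: meval_even_odd[of F z] meval_even_odd_uminus hip_scale c_def[symmetric])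
  thus ?thesis by simp
qed

text \<open>A scalar matrix element of F(-z) F(z)^(-1), so that the maximum principle for
  complex-valued functions applies.\<close>

definition transfer :: "complex^'n \<Rightarrow> complex^'n \<Rightarrow> complex \<Rightarrow> complex" where
  "transfer y u z = hip y (meval F (- z) *v (matrix_inv (meval F z) *v u))"

lemma transfer_holomorphic: "transfer y u holomorphic_on {z. det (meval F z) \<noteq> 0}"
  unfolding transfer_def
  by (intro holomorphic_hip_mult holomorphic_matrix_inv holomorphic_meval holomorphic_intros) simp

lemma transfer_tendsto: "(transfer y u \<longlongrightarrow> (- 1) ^ n * hip y u) at_infinity"
proof -
  define C where "C = (\<lambda>z. mat (inverse (z ^ n)) ** meval F z)"
  have C: "(C \<longlongrightarrow> mat 1) at_infinity"
    unfolding C_def monic(1)[symmetric] by (intro meval_tendsto_mcoeff monic)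
  have "filterlim (\<lambda>z::complex. - z) at_infinity at_infinity"
    by (rule filterlim_norm_at_top_imp_at_infinity) (simp add: filterlim_norm_at_top)
  from filterlim_compose[OF C this]
  have C': "((\<lambda>z. C (- z)) \<longlongrightarrow> mat 1) at_infinity" .
  have inv1: "matrix_inv (mat 1 :: complex^'n^'n) = mat 1"
    by (rule matrix_inv_unique) simp
  have "((\<lambda>z. (- 1) ^ n * hip y (C (- z) *v (matrix_inv (C z) *v u))) \<longlongrightarrow>
      (- 1) ^ n * hip y (mat 1 *v (matrix_inv (mat 1) *v u))) at_infinity"
    by (intro tendsto_intros C C') simp
  moreover have det_C: "eventually (\<lambda>z. det (C z) \<noteq> 0) at_infinity"
    by (rule tendsto_imp_eventually_ne[OF tendsto_det[OF C]]) simp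
  have "eventually (\<lambda>z. (- 1) ^ n * hip y (C (- z) *v (matrix_inv (C z) *v u)) = transfer y u z) at_infinity"
    using det_C eventually_not_equal_at_infinity[of 0]
  proof eventually_elim
    case (elim z)
    hence dz: "det (meval F z) \<noteq> 0"
      by (auto simp: C_def det_mul)
    have "(- 1 :: complex) ^ n * (- 1) ^ n = 1"
      by (simp add: power_mult_distrib[symmetric])
    thus ?case
      using dz elim(2)
      by (simp add: C_def transfer_def matrix_inv_mat_mult matrix_vector_mul_assoc[symmetric]
          mat_vector_mult scale_matrix_vector_mult hip_scale power_minus[of z] field_simps)
  qed
  ultimately have "(transfer y u \<longlongrightarrow> (- 1) ^ n * hip y (mat 1 *v (matrix_inv (mat 1) *v u))) at_infinity"
    by (rule Lim_transform_eventually)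
  thus ?thesis by (simp add: inv1)
qed

text \<open>Both vectors are frozen at the given \<open>z\<close>: with \<open>y\<close> equal to
  the output there, \<open>transfer y u\<close> has the value \<open>(norm y)\<^sup>2\<close> at
  \<open>z\<close>, while the maximum principle bounds it by \<open>norm y * norm u\<close>.\<close>

lemma norm_right_half_plane:
  assumes "Re z \<ge> 0"
  shows "norm (meval F (- z) *v x) \<le> norm (meval F z *v x)"
proof -
  define u y where "u = meval F z *v x" and "y = meval F (- z) *v x"
  have "norm (transfer y u z) \<le> norm y * norm u"
  proof (rule maximum_modulus_right_half_plane[where f = "transfer y u" and l = "(- 1) ^ n * hip y u"])
    show "transfer y u holomorphic_on {z. Re z > 0}"
      using transfer_holomorphic by (rule holomorphic_on_subset) (use stable in auto)
    show "continuous_on {z. Re z \<ge> 0} (transfer y u)"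
      using holomorphic_on_imp_continuous_on[OF transfer_holomorphic]
      by (rule continuous_on_subset) (use stable in auto)
    show "(transfer y u \<longlongrightarrow> (- 1) ^ n * hip y u) at_infinity"
      by (rule transfer_tendsto)
    show "norm ((- 1) ^ n * hip y u) \<le> norm y * norm u"
      by (simp add: norm_mult norm_power norm_hip_le)
    show "Re z \<ge> 0" by fact
    show "norm (transfer y u s) \<le> norm y * norm u" if "Re s = 0" for s
    proof -
      have "norm (meval F (- s) *v (matrix_inv (meval F s) *v u)) = norm u"
        using norm_imaginary_axis[OF that] stable[of s] that by (simp add: matrix_inv_vector_mult)
      thus ?thesis
        unfolding transfer_def using norm_hip_le[of y] by metis
    qed
  qed
  moreover have "transfer y u z = of_real ((norm y)\<^sup>2)"
    using stable[OF assms] by (simp add: transfer_def u_def matrix_inv_vector_mult hip_self flip: y_def)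
  ultimately have "norm y * norm y \<le> norm y * norm u"
    by (simp add: power2_eq_square norm_mult)
  hence "norm y \<le> norm u"
    by (cases "y = 0") (simp_all add: mult_le_cancel_left)
  thus ?thesis by (simp add: u_def y_def)
qed

lemma Re_hip_odd_even_nonneg:
  assumes "Re s \<ge> 0"
  shows "Re (cnj s * hip (Od (s\<^sup>2) *v x) (Ev (s\<^sup>2) *v x)) \<ge> 0"
proof -
  have "(norm (meval F (- s) *v x))\<^sup>2 \<le> (norm (meval F s *v x))\<^sup>2"
    using norm_right_half_plane[OF assms] by (intro power_mono) auto
  hence "Re (hip (Ev (s\<^sup>2) *v x) (s *s (Od (s\<^sup>2) *v x))) \<ge> 0"
    using norm_add_diff_power2[of "Ev (s\<^sup>2) *v x" "s *s (Od (s\<^sup>2) *v x)"]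
    unfolding meval_even_odd[of F s] meval_even_odd_uminus by linarith
  also have "Re (hip (Ev (s\<^sup>2) *v x) (s *s (Od (s\<^sup>2) *v x))) = Re (hip (s *s (Od (s\<^sup>2) *v x)) (Ev (s\<^sup>2) *v x))"
    by (rule Re_hip_commute)
  finally show ?thesis by (simp only: hip_scale)
qed

text \<open>If \<^term>\<open>Od\<close> were singular inside, the contraction \<^term>\<open>\<lambda>z. meval F (- z) ** matrix_inv (meval F z)\<close>
  would have a fixed vector there, hence everywhere by the maximum principle.\<close>

lemma odd_nonsingular:
  assumes s: "Re s > 0"
  shows "det (Od (s\<^sup>2)) \<noteq> 0"
proof
  assume "det (Od (s\<^sup>2)) = 0"
  then obtain v where v: "v \<noteq> 0" "Od (s\<^sup>2) *v v = 0"
    unfolding det_eq_0_iff_kernel by blast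
  define u where "u = meval F s *v v"
  have u: "meval F (- s) *v v = u"
    using v by (simp add: u_def meval_even_odd[of F s] meval_even_odd_uminus)
  have u0: "u \<noteq> 0" using kernel_F[of s v] v s by (auto simp: u_def)
  have le: "norm (meval F (- z) *v (matrix_inv (meval F z) *v u)) \<le> norm u" if "Re z > 0" for z
    using norm_right_half_plane[of z "matrix_inv (meval F z) *v u"] stable[of z] that
    by (simp add: matrix_inv_vector_mult)
  have val: "transfer u u s = of_real ((norm u)\<^sup>2)"
    unfolding transfer_def using stable[of s] s
    by (subst (2) u_def) (simp add: matrix_inv_vector_mult u hip_self)
  have "transfer u u constant_on {z. Re z > 0}"
  proof (rule maximum_modulus_principle[where \<xi> = s])
    show "transfer u u holomorphic_on {z. Re z > 0}"
      using transfer_holomorphic by (rule holomorphic_on_subset) (use stable in auto)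
    show "connected {z. Re z > 0}"
      by (intro convex_connected convex_halfspace_Re_gt)
    show "norm (transfer u u z) \<le> norm (transfer u u s)" if "z \<in> {z. Re z > 0}" for z
    proof -
      have "norm (transfer u u z) \<le> norm u * norm u"
        unfolding transfer_def using le[of z] that
        by (intro order_trans[OF norm_hip_le] mult_left_mono) auto
      thus ?thesis by (simp add: val power2_eq_square norm_mult)
    qed
  qed (use s open_halfspace_Re_gt in auto)
  hence const: "transfer u u z = of_real ((norm u)\<^sup>2)" if "Re z > 0" for z
    using that s val unfolding constant_on_def by (metis mem_Collect_eq)
  have sing: "det (Od (z\<^sup>2)) = 0" if z: "Re z > 0" for z
  proof -
    define x where "x = matrix_inv (meval F z) *v u"
    have x: "meval F z *v x = u"
      using stable[of z] z by (simp add: x_def matrix_inv_vector_mult)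
    define y where "y = meval F (- z) *v x"
    have "Re (hip u y) = (norm u)\<^sup>2"
      using const[OF z] by (simp add: transfer_def x_def y_def)
    moreover have "(norm y)\<^sup>2 \<le> (norm u)\<^sup>2"
      using le[OF z] by (simp add: y_def x_def)
    \<comment> \<open>Equality case of Cauchy-Schwarz: \<open>y\<close> is no longer than
      \<open>u\<close> and has full component along it, so \<open>y = u\<close>.\<close>
    ultimately have "(norm (u - y))\<^sup>2 \<le> 0"
      by (simp add: Re_hip power2_norm_eq_inner algebra_simps inner_commute)
    hence "u = y" by simp
    hence "meval F z *v x - meval F (- z) *v x = 0"
      using x by (simp add: y_def)
    hence "z *s (Od (z\<^sup>2) *v x) + z *s (Od (z\<^sup>2) *v x) = 0"
      unfolding meval_even_odd[of F z] meval_even_odd_uminus by simp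
    hence "Od (z\<^sup>2) *v x = 0"
      using z by (auto simp: vec_eq_iff)
    moreover have "x \<noteq> 0" using x u0 by auto
    ultimately show ?thesis unfolding det_eq_0_iff_kernel by blast
  qed
  \<comment> \<open>The determinant of the odd part would have infinitely many zeros, against
    regularity.\<close>
  have "{0<..} \<subseteq> {t :: real. poly (det (odd_part F)) (of_real t) = 0}"
  proof safe
    fix t :: real
    assume "t > 0"
    thus "poly (det (odd_part F)) (of_real t) = 0"
      using sing[of "of_real (sqrt t)"] by (simp add: det_meval flip: of_real_power)
  qed
  thus False
    using finite_zeros_of_real[OF regular] infinite_Ioi[of "0::real"] finite_subset by blast
qed

lemma zeros_odd_sqrt_imaginary:
  assumes "Od w *v x = 0" "x \<noteq> 0"
  shows "Re (csqrt w) = 0"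
  using odd_nonsingular[of "csqrt w"] assms csqrt_principal[of w] det_eq_0_iff_kernel[of "Od w"]
  by auto

text \<open>The form h(s) of the overview. Impedances of passive networks are the classical positive
  real functions.\<close>

definition impedance :: "complex^'n \<Rightarrow> complex \<Rightarrow> complex" where
  "impedance u s = hip u (Ev (s\<^sup>2) *v (matrix_inv (Od (s\<^sup>2)) *v u)) / s"

lemma impedance_odd:
  assumes "Re s > 0"
  shows "impedance (Od (s\<^sup>2) *v x) s = hip (Od (s\<^sup>2) *v x) (Ev (s\<^sup>2) *v x) / s"
  using odd_nonsingular[OF assms] by (simp add: impedance_def matrix_inv_vector_mult)

lemma odd_range:
  assumes "Re s > 0"
  obtains x where "u = Od (s\<^sup>2) *v x"
  using odd_nonsingular[OF assms] matrix_inv_vector_mult(1) by metis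

lemma impedance_holomorphic: "impedance u holomorphic_on {s. Re s > 0}"
  unfolding impedance_def
  by (intro holomorphic_intros holomorphic_hip_mult holomorphic_matrix_inv holomorphic_meval)
    (use odd_nonsingular in auto)

lemma impedance_nonneg:
  assumes "Re s > 0"
  shows "Re (impedance u s) \<ge> 0"
proof -
  obtain x where x: "u = Od (s\<^sup>2) *v x" using odd_range[OF assms] .
  have "impedance u s = cnj s * hip (Od (s\<^sup>2) *v x) (Ev (s\<^sup>2) *v x) / of_real ((norm s)\<^sup>2)"
    unfolding x impedance_odd[OF assms] by (subst complex_div_cnj) (simp add: mult.commute)
  thus ?thesis
    using Re_hip_odd_even_nonneg[of s x] assms by (simp only: Re_divide_of_real) simp
qed

lemma impedance_real:
  assumes "t > 0"
  shows "Im (impedance u (of_real t)) = 0"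
proof -
  have "Re (of_real t :: complex) > 0" using assms by simp
  then obtain x where x: "u = Od ((of_real t)\<^sup>2) *v x" using odd_range by blast
  define c where "c = hip (Od ((of_real t)\<^sup>2) *v x) (Ev ((of_real t)\<^sup>2) *v x)"
  have "cnj c = c"
    using hermitian[of "t\<^sup>2" x x] by (simp add: c_def cnj_hip)
  hence "Im c = 0" by (simp add: complex_eq_iff)
  thus ?thesis
    using assms unfolding x by (simp add: impedance_odd c_def[symmetric])
qed

text \<open>With \<open>s = csqrt w\<close> the form of \<open>Rtilde F\<close> at \<open>w\<close>
  is \<open>- impedance u s / s\<close>, and \<open>s\<close> lies in the open first quadrant, where
  the sector bound fixes the sign of its imaginary part.\<close>

lemma Im_Rtilde_nonneg:
  assumes "Im w > 0"
  shows "Im (hip u (rmat_eval (Rtilde F) w *v u)) \<ge> 0"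
proof -
  define s where "s = csqrt w"
  have s2: "s\<^sup>2 = w" by (simp add: s_def)
  have "Re s * Im s > 0"
    using assms unfolding s2[symmetric] by (simp add: power2_eq_square mult.commute)
  moreover have "Re s \<ge> 0" using csqrt_principal[of w] by (auto simp: s_def)
  ultimately have s: "Re s > 0" "Im s > 0" by (auto simp: zero_less_mult_iff)
  have w0: "w \<noteq> 0" using assms by auto
  obtain x where x: "u = Od w *v x" using odd_range[OF s(1)] unfolding s2 .
  define c where "c = hip u (Ev w *v x)"
  have "Im (impedance u s * cnj s) \<le> 0"
    using s by (intro positive_real_Im_mult_cnj impedance_holomorphic impedance_nonneg impedance_real) auto
  also have "impedance u s * cnj s = c * cnj w / of_real ((norm s)\<^sup>2)"
    using impedance_odd[OF s(1), of x] unfolding s2 x[symmetric] c_def[symmetric]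
    by (simp, subst complex_div_cnj) (simp add: s2[symmetric] power2_eq_square)
  finally have le: "Im (c * cnj w) \<le> 0"
    using s by (simp only: Im_divide_of_real) (auto simp: divide_le_0_iff)
  have "rmat_eval (Rtilde F) w *v (w *s u) = - (Ev w *v x)"
    unfolding x using w0 odd_nonsingular[OF s(1)] by (intro Rtilde_mult_vec) (simp_all add: s2)
  hence "w * hip u (rmat_eval (Rtilde F) w *v u) = - c"
    by (simp add: c_def hip_minus scale_matrix_vector_mult flip: hip_scale(2))
  hence "hip u (rmat_eval (Rtilde F) w *v u) = - c / w"
    using w0 by (simp add: field_simps)
  also have "\<dots> = - (c * cnj w) / of_real ((norm w)\<^sup>2)"
    by (subst complex_div_cnj) simp
  finally show ?thesis
    using le by (simp only: Im_divide_of_real) (simp add: divide_nonneg_nonneg)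
qed

lemma Re_Rtilde_nonpos:
  assumes "t > 0"
  shows "Re (hip u (rmat_eval (Rtilde F) (of_real t) *v u)) \<le> 0"
proof -
  define s where "s = complex_of_real (sqrt t)"
  have s: "Re s > 0" using assms by (simp add: s_def)
  have s2: "s\<^sup>2 = of_real t" using assms by (simp add: s_def flip: of_real_power)
  obtain x where x: "u = Od (of_real t) *v x" using odd_range[OF s] unfolding s2 .
  define c where "c = hip u (Ev (of_real t) *v x)"
  have "rmat_eval (Rtilde F) (of_real t) *v (of_real t *s u) = - (Ev (of_real t) *v x)"
    unfolding x using assms odd_nonsingular[OF s] by (intro Rtilde_mult_vec) (simp_all add: s2)
  hence "of_real t * hip u (rmat_eval (Rtilde F) (of_real t) *v u) = - c"
    by (simp add: c_def hip_minus scale_matrix_vector_mult flip: hip_scale(2))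
  hence "t * Re (hip u (rmat_eval (Rtilde F) (of_real t) *v u)) = - Re c"
    by (simp add: complex_eq_iff)
  moreover have "Re c \<ge> 0"
    using Re_hip_odd_even_nonneg[of s x] s assms unfolding s2 x[symmetric] c_def[symmetric]
    by (simp add: s_def zero_le_mult_iff)
  ultimately show ?thesis
    using assms by (smt (verit) mult_pos_pos)
qed

text \<open>This is a bound on the growth of \<^term>\<open>\<lambda>w. Ev w ** matrix_inv (Od w)\<close>, from which all poles
  are simple, at infinity as well as at the finite ones.\<close>

lemma even_le_odd:
  "\<exists>K\<ge>0. \<forall>s x. Re s > 0 \<longrightarrow>
    Re s * norm (Ev (s\<^sup>2) *v x) \<le> K * norm s * (norm s + 1)\<^sup>2 * norm (Od (s\<^sup>2) *v x)"
proof -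
  \<comment> \<open>The growth estimate carries the value of the form at 1 as its constant;
    \<open>K\<close> bounds that value uniformly in \<open>u\<close> by a multiple of
    \<open>(norm u)\<^sup>2\<close>.\<close>
  obtain K where K: "K \<ge> 0" "\<And>x. norm ((Ev 1 ** matrix_inv (Od 1)) *v x) \<le> K * norm x"
    using matrix_vector_bound by blast
  have h1: "norm (impedance u 1) \<le> K * (norm u)\<^sup>2" for u
  proof -
    have "norm (impedance u 1) \<le> norm u * (K * norm u)"
      using K(2)[of u] unfolding impedance_def
      by (simp add: matrix_vector_mul_assoc)
        (rule order_trans[OF norm_hip_le mult_left_mono], auto)
    thus ?thesis by (simp add: power2_eq_square mult_ac)
  qed
  have "Re s * norm (Ev (s\<^sup>2) *v x) \<le> 4 * K * norm s * (norm s + 1)\<^sup>2 * norm (Od (s\<^sup>2) *v x)"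
    if s: "Re s > 0" for s x
  proof -
    define A where "A = Ev (s\<^sup>2) ** matrix_inv (Od (s\<^sup>2))"
    define C where "C = K * norm s * (norm s + 1)\<^sup>2 / Re s"
    have "norm (hip u (A *v u)) \<le> C * (norm u)\<^sup>2" for u
    proof -
      define b where "b = Re (impedance u 1)"
      have b: "impedance u 1 = of_real b"
        using impedance_real[of 1 u] by (simp add: b_def complex_eq_iff)
      have "b \<le> K * (norm u)\<^sup>2"
        using h1[of u] complex_Re_le_cmod[of "impedance u 1"] by (simp add: b_def)
      have "norm (impedance u s) * Re s \<le> b * (norm s + 1)\<^sup>2"
        using s b by (intro positive_real_growth impedance_holomorphic impedance_nonneg) auto
      also have "\<dots> \<le> K * (norm u)\<^sup>2 * (norm s + 1)\<^sup>2"
        using \<open>b \<le> K * (norm u)\<^sup>2\<close> by (intro mult_right_mono) auto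
      finally have "norm (impedance u s) \<le> K * (norm u)\<^sup>2 * (norm s + 1)\<^sup>2 / Re s"
        using s by (simp add: field_simps)
      hence "norm s * norm (impedance u s) \<le> norm s * (K * (norm u)\<^sup>2 * (norm s + 1)\<^sup>2 / Re s)"
        by (intro mult_left_mono) auto
      moreover have "norm s * norm (impedance u s) = norm (hip u (A *v u))"
        using s by (auto simp: impedance_def A_def norm_divide matrix_vector_mul_assoc)
      ultimately show ?thesis by (simp add: C_def mult_ac)
    qed
    hence "norm (A *v (Od (s\<^sup>2) *v x)) \<le> 4 * C * norm (Od (s\<^sup>2) *v x)"
      using s K(1) by (intro norm_matrix_le_of_numerical_radius) (auto simp: C_def)
    hence "norm (Ev (s\<^sup>2) *v x) \<le> 4 * C * norm (Od (s\<^sup>2) *v x)"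
      using odd_nonsingular[OF s]
      by (simp add: A_def matrix_vector_mul_assoc[symmetric] matrix_inv_vector_mult)
    thus ?thesis using s by (simp add: C_def field_simps)
  qed
  thus ?thesis using K(1) by (intro exI[of _ "4 * K"]) auto
qed

text \<open>Approach \<open>s\<close> horizontally with a vector corrected by the chain: the odd
  part is then of smaller order than the distance \<open>t\<close> to the axis. After cancelling
  \<open>t\<close>, the growth bound forces the even part to annihilate \<open>u\<close> in the
  limit, so \<open>u\<close> lies in the kernel of \<open>F\<close> at \<open>s\<close>.\<close>

lemma no_jordan_chain:
  assumes s: "Re s = 0"
    and N: "\<And>w x. Od w *v x = Od (s\<^sup>2) *v x + (w - s\<^sup>2) *s (meval N w *v x)"
    and u: "Od (s\<^sup>2) *v u = 0" and v: "meval N (s\<^sup>2) *v u + Od (s\<^sup>2) *v v = 0"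
  shows "u = 0"
proof -
  obtain K where K: "\<And>s x. Re s > 0 \<Longrightarrow>
    Re s * norm (Ev (s\<^sup>2) *v x) \<le> K * norm s * (norm s + 1)\<^sup>2 * norm (Od (s\<^sup>2) *v x)"
    using even_le_odd by blast
  define r where "r = (\<lambda>t::real. s + of_real t)"
  \<comment> \<open>The correction by \<open>v\<close> makes the odd part of \<open>x t\<close>
    equal to \<open>(r t)\<^sup>2 - s\<^sup>2\<close> times \<open>y t\<close>, and
    \<open>y t\<close> tends to 0 by the chain relation.\<close>
  define x where "x = (\<lambda>t. u + ((r t)\<^sup>2 - s\<^sup>2) *s v)"
  define y where "y = (\<lambda>t. meval N ((r t)\<^sup>2) *v u + Od ((r t)\<^sup>2) *v v)"
  have r: "(r \<longlongrightarrow> s) (at_right 0)"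
    unfolding r_def by (rule tendsto_eq_intros refl)+ simp
  have le: "norm (Ev ((r t)\<^sup>2) *v x t) \<le> K * norm (r t) * (norm (r t) + 1)\<^sup>2 * norm ((r t + s) *s y t)"
    if t: "t > 0" for t
  proof -
    have d: "(r t)\<^sup>2 - s\<^sup>2 = of_real t * (r t + s)"
      by (simp add: r_def power2_eq_square algebra_simps)
    have "Od ((r t)\<^sup>2) *v x t = Od ((r t)\<^sup>2) *v u + ((r t)\<^sup>2 - s\<^sup>2) *s (Od ((r t)\<^sup>2) *v v)"
      by (simp only: x_def matrix_vector_right_distrib scale_matrix_vector_mult)
    also have "Od ((r t)\<^sup>2) *v u = ((r t)\<^sup>2 - s\<^sup>2) *s (meval N ((r t)\<^sup>2) *v u)"
      by (subst N) (simp add: u)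
    finally have "Od ((r t)\<^sup>2) *v x t = of_real t *s ((r t + s) *s y t)"
      by (simp only: d y_def vector_add_ldistrib vector_smult_assoc)
    hence "norm (Od ((r t)\<^sup>2) *v x t) = t * norm ((r t + s) *s y t)"
      using t by (simp only: norm_scale_vec norm_of_real)
    thus ?thesis
      using K[of "r t" "x t"] t s by (simp add: r_def mult.left_commute[of _ t])
  qed
  have "norm (Ev (s\<^sup>2) *v u) \<le> 0"
  proof (rule tendsto_le[OF trivial_limit_at_right_real])
    have "((\<lambda>t. norm (Ev ((r t)\<^sup>2) *v x t)) \<longlongrightarrow> norm (Ev (s\<^sup>2) *v (u + (s\<^sup>2 - s\<^sup>2) *s v))) (at_right 0)"
      unfolding x_def by (intro tendsto_intros r)
    thus "((\<lambda>t. norm (Ev ((r t)\<^sup>2) *v x t)) \<longlongrightarrow> norm (Ev (s\<^sup>2) *v u)) (at_right 0)" by simp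
    have "((\<lambda>t. K * norm (r t) * (norm (r t) + 1)\<^sup>2 * norm ((r t + s) *s y t)) \<longlongrightarrow>
        K * norm s * (norm s + 1)\<^sup>2 * norm ((s + s) *s (meval N (s\<^sup>2) *v u + Od (s\<^sup>2) *v v))) (at_right 0)"
      unfolding y_def by (intro tendsto_intros r)
    thus "((\<lambda>t. K * norm (r t) * (norm (r t) + 1)\<^sup>2 * norm ((r t + s) *s y t)) \<longlongrightarrow> 0) (at_right 0)"
      by (simp add: v)
    show "eventually (\<lambda>t. norm (Ev ((r t)\<^sup>2) *v x t) \<le>
        K * norm (r t) * (norm (r t) + 1)\<^sup>2 * norm ((r t + s) *s y t)) (at_right 0)"
      using eventually_at_right_less[of 0] by eventually_elim (rule le)
  qed
  hence "meval F s *v u = 0" by (simp add: meval_even_odd[of F s] u)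
  thus ?thesis using kernel_F[of s u] s by simp
qed

lemma simple_odd: "msimple (odd_part F)"
  unfolding msimple_def mregular_def
proof (intro conjI regular ballI)
  fix w
  assume "w \<in> mzeros (odd_part F)"
  then obtain x where x: "Od w *v x = 0" "x \<noteq> 0"
    by (auto simp: mzeros_def det_eq_0_iff_kernel)
  define s where "s = csqrt w"
  have s: "s\<^sup>2 = w" "Re s = 0"
    using zeros_odd_sqrt_imaginary[OF x] by (simp_all add: s_def)
  show "order w (det (odd_part F)) = nullity (Od w)"
  proof (rule meval_factor[of "odd_part F" w])
    fix N
    assume N: "\<And>z x. Od z *v x = Od w *v x + (z - w) *s (meval N z *v x)"
    have "u = 0" if "Od w *v u = 0" "meval N w *v u + Od w *v v = 0" for u v
      by (rule no_jordan_chain[OF s(2), unfolded s(1), OF N that])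
    with regular N show ?thesis by (rule order_det_eq_nullity)
  qed
qed

text \<open>Along the positive axis \<open>Re s\<close> and \<open>norm s\<close> cancel, so the
  growth bound stays finite at 0 and passes to the limit; a kernel vector of the odd part would be
  one of \<open>F\<close> at 0.\<close>

lemma odd_nonsingular_0: "det (Od 0) \<noteq> 0"
proof
  assume "det (Od 0) = 0"
  then obtain v where v: "v \<noteq> 0" "Od 0 *v v = 0"
    unfolding det_eq_0_iff_kernel by blast
  obtain K where K: "\<And>s x. Re s > 0 \<Longrightarrow>
    Re s * norm (Ev (s\<^sup>2) *v x) \<le> K * norm s * (norm s + 1)\<^sup>2 * norm (Od (s\<^sup>2) *v x)"
    using even_le_odd by blast
  define r where "r = (\<lambda>t::real. complex_of_real t)"
  have r: "(r \<longlongrightarrow> 0) (at_right 0)"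
    unfolding r_def by (rule tendsto_eq_intros refl)+ simp
  have "norm (Ev 0 *v v) \<le> 0"
  proof (rule tendsto_le[OF trivial_limit_at_right_real])
    have "((\<lambda>t. norm (Ev ((r t)\<^sup>2) *v v)) \<longlongrightarrow> norm (Ev (0\<^sup>2) *v v)) (at_right 0)"
      by (intro tendsto_intros r)
    thus "((\<lambda>t. norm (Ev ((r t)\<^sup>2) *v v)) \<longlongrightarrow> norm (Ev 0 *v v)) (at_right 0)" by simp
    have "((\<lambda>t. K * (norm (r t) + 1)\<^sup>2 * norm (Od ((r t)\<^sup>2) *v v)) \<longlongrightarrow>
        K * (norm (0::complex) + 1)\<^sup>2 * norm (Od (0\<^sup>2) *v v)) (at_right 0)"
      by (intro tendsto_intros r)
    thus "((\<lambda>t. K * (norm (r t) + 1)\<^sup>2 * norm (Od ((r t)\<^sup>2) *v v)) \<longlongrightarrow> 0) (at_right 0)"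
      by (simp add: v)
    show "eventually (\<lambda>t. norm (Ev ((r t)\<^sup>2) *v v) \<le>
        K * (norm (r t) + 1)\<^sup>2 * norm (Od ((r t)\<^sup>2) *v v)) (at_right 0)"
      using eventually_at_right_less[of 0]
    proof eventually_elim
      case (elim t)
      thus ?case using K[of "r t" v] by (simp add: r_def mult_ac)
    qed
  qed
  hence "meval F 0 *v v = 0" by (simp add: meval_even_odd[of F 0])
  thus False using kernel_F[of 0 v] v by simp
qed

lemma zeros_odd_negative:
  assumes "w \<in> mzeros (odd_part F)"
  shows "w \<in> \<real> \<and> Re w < 0"
proof -
  obtain x where x: "Od w *v x = 0" "x \<noteq> 0"
    using assms by (auto simp: mzeros_def det_eq_0_iff_kernel)
  define s where "s = csqrt w"
  have s: "s\<^sup>2 = w" "Re s = 0"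
    using zeros_odd_sqrt_imaginary[OF x] by (simp_all add: s_def)
  have "w \<noteq> 0" using assms odd_nonsingular_0 by (auto simp: mzeros_def)
  hence "Im s \<noteq> 0" using s by (auto simp: complex_eq_iff power2_eq_square)
  moreover have "Re w = - (Im s)\<^sup>2" "Im w = 0"
    using s by (auto simp: power2_eq_square)
  ultimately show ?thesis by (simp add: complex_is_Real_iff)
qed

text \<open>The growth bound at infinity, normalized by leading powers: a kernel vector of the
  coefficient of the odd part would be annihilated by that of the even part, which is the
  identity.\<close>

lemma leading_odd_nonsingular:
  assumes n: "n = 2 * Suc d"
  shows "det (mcoeff (odd_part F) d) \<noteq> 0"
proof
  assume "det (mcoeff (odd_part F) d) = 0"
  then obtain v where v: "v \<noteq> 0" "mcoeff (odd_part F) d *v v = 0"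
    unfolding det_eq_0_iff_kernel by blast
  obtain K where K: "\<And>s x. Re s > 0 \<Longrightarrow>
    Re s * norm (Ev (s\<^sup>2) *v x) \<le> K * norm s * (norm s + 1)\<^sup>2 * norm (Od (s\<^sup>2) *v x)"
    using even_le_odd by blast
  define w where "w = (\<lambda>t::real. (complex_of_real t)\<^sup>2)"
  have "filterlim (\<lambda>t::real. t\<^sup>2) at_top at_top"
    by (rule filterlim_pow_at_top) (simp_all add: filterlim_ident)
  hence w: "filterlim w at_infinity at_top"
    by (intro filterlim_norm_at_top_imp_at_infinity) (simp add: w_def norm_power)
  have E: "((\<lambda>t. (mat (inverse (w t ^ Suc d)) ** Ev (w t)) *v v) \<longlongrightarrow> mcoeff (even_part F) (Suc d) *v v) at_top"
    by (intro tendsto_intros filterlim_compose[OF meval_tendsto_mcoeff w])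
      (simp add: mcoeff_even_part monic n)
  have Od: "((\<lambda>t. (mat (inverse (w t ^ d)) ** Od (w t)) *v v) \<longlongrightarrow> mcoeff (odd_part F) d *v v) at_top"
    by (intro tendsto_intros filterlim_compose[OF meval_tendsto_mcoeff w])
      (simp add: mcoeff_odd_part monic n)
  have "norm (mcoeff (even_part F) (Suc d) *v v) \<le> K * (1 + 0)\<^sup>2 * norm (mcoeff (odd_part F) d *v v)"
  proof (rule tendsto_le[OF trivial_limit_at_top_linorder])
    show "((\<lambda>t. norm ((mat (inverse (w t ^ Suc d)) ** Ev (w t)) *v v)) \<longlongrightarrow>
        norm (mcoeff (even_part F) (Suc d) *v v)) at_top"
      by (intro tendsto_intros E)
    show "((\<lambda>t. K * (1 + inverse t)\<^sup>2 * norm ((mat (inverse (w t ^ d)) ** Od (w t)) *v v)) \<longlongrightarrow>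
        K * (1 + 0)\<^sup>2 * norm (mcoeff (odd_part F) d *v v)) at_top"
      by (intro tendsto_intros Od tendsto_inverse_0_at_top filterlim_ident)
    show "eventually (\<lambda>t. norm ((mat (inverse (w t ^ Suc d)) ** Ev (w t)) *v v) \<le>
        K * (1 + inverse t)\<^sup>2 * norm ((mat (inverse (w t ^ d)) ** Od (w t)) *v v)) at_top"
      using eventually_gt_at_top[of 0]
    proof eventually_elim
      case (elim t)
      have nm: "norm ((mat (inverse (w t ^ k)) ** A) *v v) = norm (A *v v) / (t\<^sup>2) ^ k"
        for A :: "complex^'n^'n" and k
        by (simp add: matrix_vector_mul_assoc[symmetric] mat_vector_mult norm_scale_vec w_def
            norm_inverse norm_power divide_inverse mult.commute)
      have "norm (Ev (w t) *v v) \<le> K * (t + 1)\<^sup>2 * norm (Od (w t) *v v)"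
        using K[of "of_real t" v] elim by (simp add: w_def mult_ac)
      hence "norm (Ev (w t) *v v) / (t\<^sup>2) ^ Suc d \<le> K * (t + 1)\<^sup>2 * norm (Od (w t) *v v) / (t\<^sup>2) ^ Suc d"
        by (rule divide_right_mono) simp
      \<comment> \<open>One of the \<open>Suc d\<close> factors \<open>t\<^sup>2\<close> normalizes
        \<open>(t + 1)\<^sup>2\<close>; the other \<open>d\<close> normalize the odd part.\<close>
      also have "\<dots> = K * (1 + inverse t)\<^sup>2 * (norm (Od (w t) *v v) / (t\<^sup>2) ^ d)"
      proof -
        have "(1 + inverse t)\<^sup>2 = (t + 1)\<^sup>2 / t\<^sup>2"
          using elim by (simp add: field_simps power2_eq_square)
        thus ?thesis by (simp add: mult_ac)
      qed
      finally show ?case by (simp only: nm)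
    qed
  qed
  thus False using v monic(1) by (simp add: mcoeff_even_part n)
qed

text \<open>Self-adjointness and semidefiniteness pass to the limit along the positive axis. As the
  even part is monic here, the limit is minus the inverse of a matrix, and injectivity upgrades
  semidefinite to definite.\<close>

lemma Rtilde_limit_neg_definite:
  assumes n: "n = 2 * Suc d"
  shows "\<exists>L. (rmat_eval (Rtilde F) \<longlongrightarrow> L) at_infinity \<and> neg_definite L"
proof -
  define A where "A = mcoeff (odd_part F) d"
  have A: "det A \<noteq> 0" unfolding A_def by (rule leading_odd_nonsingular[OF n])
  define L where "L = - (mcoeff (even_part F) (Suc d) ** matrix_inv A)"
  have lim: "(rmat_eval (Rtilde F) \<longlongrightarrow> L) at_infinity"
    unfolding L_def A_def using A
    by (intro Rtilde_tendsto) (simp_all add: mcoeff_even_part mcoeff_odd_part monic n A_def)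
  have L: "L *v u = - (matrix_inv A *v u)" for u
    using monic(1) by (simp add: L_def mcoeff_even_part n matrix_vector_mult_uminus_left)
  define R where "R = (\<lambda>t::real. rmat_eval (Rtilde F) (of_real t))"
  have R: "(R \<longlongrightarrow> L) at_top"
    unfolding R_def by (rule filterlim_compose[OF lim filterlim_of_real_at_infinity])
  have herm: "hip (R t *v x) y = hip x (R t *v y)" if t: "t > 0" for t x y
  proof -
    have od: "det (Od (of_real t)) \<noteq> 0"
      using odd_nonsingular[of "of_real (sqrt t)"] t by (simp flip: of_real_power)
    have w: "(of_real t :: complex) \<noteq> 0" using t by simp
    define X where "X = (\<lambda>x. inverse (of_real t) *s (matrix_inv (Od (of_real t)) *v x))"
    have X: "of_real t *s (Od (of_real t) *v X x) = x" for x
      using od w by (simp add: X_def scale_matrix_vector_mult matrix_inv_vector_mult)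
    have RX: "R t *v x = - (Ev (of_real t) *v X x)" for x
      using Rtilde_mult_vec[OF w od, of "X x"] unfolding X by (simp add: R_def)
    have "hip (R t *v x) (of_real t *s (Od (of_real t) *v X y)) =
        hip (of_real t *s (Od (of_real t) *v X x)) (R t *v y)"
      unfolding RX using hermitian[of t "X x" "X y"] by (simp add: hip_scale hip_minus)
    thus ?thesis by (simp only: X)
  qed
  have "hip (L *v x) y = hip x (L *v y)" for x y
  proof (rule tendsto_unique[OF trivial_limit_at_top_linorder])
    show "((\<lambda>t. hip (R t *v x) y) \<longlongrightarrow> hip (L *v x) y) at_top" by (intro tendsto_intros R)
    have "((\<lambda>t. hip x (R t *v y)) \<longlongrightarrow> hip x (L *v y)) at_top" by (intro tendsto_intros R)
    moreover have "eventually (\<lambda>t. hip x (R t *v y) = hip (R t *v x) y) at_top"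
      using eventually_gt_at_top[of 0] by eventually_elim (simp add: herm)
    ultimately show "((\<lambda>t. hip (R t *v x) y) \<longlongrightarrow> hip x (L *v y)) at_top"
      by (rule Lim_transform_eventually)
  qed
  hence sa: "self_adjoint L" unfolding self_adjoint_def by (rule ctranspose_eqI)
  have neg: "Re (hip u (L *v u)) \<le> 0" for u
  proof (rule tendsto_upperbound[OF _ _ trivial_limit_at_top_linorder])
    show "((\<lambda>t. Re (hip u (R t *v u))) \<longlongrightarrow> Re (hip u (L *v u))) at_top" by (intro tendsto_intros R)
    show "eventually (\<lambda>t. Re (hip u (R t *v u)) \<le> 0) at_top"
      using eventually_gt_at_top[of 0] by eventually_elim (simp add: R_def Re_Rtilde_nonpos)
  qed
  have "Re (hip u (L *v u)) \<noteq> 0" if "u \<noteq> 0" for u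
  proof
    assume "Re (hip u (L *v u)) = 0"
    hence "matrix_inv A *v u = 0"
      using negative_semidefinite_kernel[OF sa neg, of u] by (simp add: L)
    hence "u = 0" using matrix_inv_vector_mult(1)[OF A, of u] by simp
    thus False using that by simp
  qed
  hence "neg_definite L"
    using sa neg by (simp add: neg_definite_def sesq_form_eq_hip order.not_eq_order_implies_strict)
  with lim show ?thesis by blast
qed

end

section \<open>Herglotz--Nevanlinna functions\<close>

lemma nonneg_definite_imaginary_part_iff:
  "nonneg_definite (mat (1 / (2 * \<i>)) ** (A - ctranspose A)) \<longleftrightarrow> (\<forall>v. 0 \<le> Im (hip v (A *v v)))"
proof -
  define B where "B = mat (1 / (2 * \<i>)) ** (A - ctranspose A)"
  have B: "B *v x = (1 / (2 * \<i>)) *s (A *v x - ctranspose A *v x)" for x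
    by (simp add: B_def matrix_vector_mul_assoc[symmetric] mat_vector_mult matrix_vector_mult_diff_rdistrib)
  have "self_adjoint B"
    unfolding self_adjoint_def
    by (rule ctranspose_eqI) (simp add: B hip_scale hip_diff hip_ctranspose hip_ctranspose_right)
  moreover have "Re (sesq_form B v) = Im (hip v (A *v v))" for v
    using cnj_hip[of v "A *v v"]
    by (simp add: sesq_form_eq_hip B hip_scale hip_diff hip_ctranspose_right Re_divide Im_divide complex_eq_iff)
  ultimately show ?thesis unfolding nonneg_definite_def B_def[symmetric] by simp
qed

text \<open>The imaginary part of \<open>f\<close> vanishes on the axis and is nonnegative above it,
  so its upward derivative is nonnegative. By Cauchy-Riemann this is the derivative of the real part
  along the axis, which therefore increases towards \<open>l\<close>.\<close>

lemma herglotz_nonpos_of_limit: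
  assumes diff: "\<And>x. x > 0 \<Longrightarrow> f field_differentiable (at (complex_of_real x))"
    and pos: "\<And>z. Im z > 0 \<Longrightarrow> Im (f z) \<ge> 0"
    and real: "\<And>x. x > 0 \<Longrightarrow> Im (f (complex_of_real x)) = 0"
    and lim: "((\<lambda>x. Re (f (of_real x))) \<longlongrightarrow> l) at_top" "l \<le> 0"
    and x: "x > 0"
  shows "Re (f (of_real x)) \<le> 0"
proof -
  define g where "g = (\<lambda>x. Re (f (of_real x)))"
  have der: "\<exists>y. DERIV g t :> y \<and> y \<ge> 0" if t: "t > 0" for t
  proof -
    obtain D where D: "(f has_field_derivative D) (at (of_real t))"
      using diff[OF t] by (auto simp: field_differentiable_def)
    from bounded_linear.has_vector_derivative[OF bounded_linear_Re has_vector_derivative_real_field[OF D]]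
    have g: "DERIV g t :> Re D"
      by (simp add: g_def has_real_derivative_iff_has_vector_derivative)
    \<comment> \<open>The vertical path through \<open>t\<close>: along it \<open>f\<close> has
      derivative \<open>D * \<i>\<close>, whose imaginary part is \<open>Re D\<close>.\<close>
    define k where "k = (\<lambda>s::real. of_real t + of_real s * \<i>)"
    have "((\<lambda>c. of_real t + c * \<i>) has_field_derivative \<i>) (at (of_real 0))"
      by (rule derivative_eq_intros refl)+ simp
    with D have "((\<lambda>c. f (of_real t + c * \<i>)) has_field_derivative D * \<i>) (at (of_real 0))"
      by (intro DERIV_chain2[where f = f]) simp_all
    hence "((\<lambda>s. f (k s)) has_vector_derivative D * \<i>) (at 0)"
      unfolding k_def by (rule has_vector_derivative_real_field)
    from bounded_linear.has_vector_derivative[OF bounded_linear_Im this]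
    have h: "DERIV (\<lambda>s. Im (f (k s))) 0 :> Re D"
      by (simp add: has_real_derivative_iff_has_vector_derivative)
    have "Re D \<ge> 0"
    proof (rule ccontr)
      assume "\<not> Re D \<ge> 0"
      hence "Re D < 0" by simp
      from DERIV_neg_dec_right[OF h this]
      obtain e where e: "e > 0" "\<And>s. 0 < s \<Longrightarrow> s < e \<Longrightarrow> Im (f (k s)) < Im (f (k 0))" by auto
      have "Im (f (k (e / 2))) < Im (f (k 0))" using e by simp
      moreover have "Im (f (k 0)) = 0" using real[OF t] by (simp add: k_def)
      moreover have "Im (f (k (e / 2))) \<ge> 0" using e(1) by (intro pos) (simp add: k_def)
      ultimately show False by simp
    qed
    with g show ?thesis by blast
  qed
  have "g x \<le> g y" if "x \<le> y" for y
    using that by (rule DERIV_nonneg_imp_nondecreasing) (use x der in auto)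
  hence "eventually (\<lambda>y. g x \<le> g y) at_top"
    by (rule eventually_at_top_linorderI)
  hence "g x \<le> l"
    using lim(1) unfolding g_def by (intro tendsto_lowerbound) auto
  thus ?thesis using lim(2) by (simp add: g_def)
qed

section \<open>Poles and holomorphy of rational matrix functions\<close>

lemma finite_rmat_poles: "finite (rmat_poles R)"
proof -
  have "rmat_poles R = (\<Union>i. \<Union>j. {z. poly (snd (quot_of_fract (R $ i $ j))) z = 0})"
    by (auto simp: rmat_poles_def rat_pole_def)
  thus ?thesis by (simp add: poly_roots_finite)
qed

lemma rmat_eval_holomorphic: "(\<lambda>z. rmat_eval R z $ i $ j) holomorphic_on - rmat_poles R"
  unfolding rmat_eval_def rat_eval_def
  by (auto intro!: holomorphic_intros simp: rmat_poles_def rat_pole_def)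

lemma hip_rmat_eval_field_differentiable:
  assumes "z \<notin> rmat_poles R"
  shows "(\<lambda>z. hip u (rmat_eval R z *v v)) field_differentiable (at z)"
proof -
  have "(\<lambda>z. hip u (rmat_eval R z *v (mat 1 *v v))) holomorphic_on - rmat_poles R"
    by (intro holomorphic_hip_mult rmat_eval_holomorphic) simp
  moreover have "open (- rmat_poles R)"
    using finite_rmat_poles by (intro open_Compl finite_imp_closed)
  ultimately show ?thesis
    using assms by (simp add: holomorphic_on_open field_differentiable_def)
qed

lemma hurwitz_of_herglotz:
  assumes sa: "rmat_self_adjoint (Rtilde F)" and reg: "det (odd_part F) \<noteq> 0"
    and lim: "(rmat_eval (Rtilde F) \<longlongrightarrow> L) at_infinity" "\<And>u. Re (hip u (L *v u)) \<le> 0"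
    and herg: "herglotz_nevanlinna (Rtilde F)"
    and coprime: "right_coprime (even_part F) (odd_part F)"
    and zeros: "\<And>w. w \<in> mzeros (odd_part F) \<Longrightarrow> w \<in> \<real> \<and> Re w < 0"
    and even0: "0 \<notin> mzeros (even_part F)"
    and z: "Re z \<ge> 0"
  shows "det (meval F z) \<noteq> 0"
proof
  assume "det (meval F z) = 0"
  then obtain v where v: "v \<noteq> 0" "meval F z *v v = 0"
    unfolding det_eq_0_iff_kernel by blast
  define w where "w = z\<^sup>2"
  define E Od R where "E = meval (even_part F)" and "Od = meval (odd_part F)"
    and "R = rmat_eval (Rtilde F)"
  have Ev: "E w *v v = - (z *s (Od w *v v))"
    using v(2) unfolding meval_even_odd[of F z] by (simp add: E_def Od_def w_def add_eq_0_iff2)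
  show False
  proof (cases "Re z = 0")
    case True
    define c where "c = hip (Od w *v v) (Od w *v v)"
    have c: "c = of_real ((norm (Od w *v v))\<^sup>2)" unfolding c_def by (rule hip_self)
    have "w = of_real (- (Im z)\<^sup>2)"
      using True by (simp add: w_def complex_eq_iff power2_eq_square)
    hence "hip (Od w *v v) (E w *v v) = hip (E w *v v) (Od w *v v)"
      using hermitian_even_odd[OF sa, of "- (Im z)\<^sup>2" v v] reg by (simp add: mregular_def E_def Od_def)
    \<comment> \<open>As \<open>z\<close> is imaginary and \<open>c\<close> is a squared norm,
      either \<open>z\<close> or the odd part of \<open>v\<close> vanishes; \<open>even0\<close>
      excludes the former, \<open>coprime\<close> the latter.\<close>
    hence "z * c = cnj z * c" by (simp add: Ev hip_minus hip_scale c_def)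
    hence "z = 0 \<or> Od w *v v = 0"
      using True by (auto simp: c complex_eq_iff)
    thus False
    proof
      assume "z = 0"
      hence "E 0 *v v = 0" using Ev by (simp add: w_def)
      thus False using even0 v(1) by (auto simp: mzeros_def det_eq_0_iff_kernel E_def)
    next
      assume "Od w *v v = 0"
      thus False
        using Ev coprime v(1) unfolding right_coprime_iff_kernel[OF reg] by (simp add: E_def Od_def)
    qed
  next
    case False
    hence z: "Re z > 0" using z by simp
    \<comment> \<open>The square of a number with positive real part avoids the closed negative
      axis, where all excluded points lie.\<close>
    have not_zero: "w' \<notin> mzeros (odd_part F) \<union> {0}" if "w' = w \<or> w' = cnj w" for w'
    proof -
      have "\<not> (w' \<in> \<real> \<and> Re w' < 0)"
      proof
        assume "w' \<in> \<real> \<and> Re w' < 0"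
        hence "Im w = 0" "Re w < 0" using that by (auto simp: complex_is_Real_iff)
        hence "Re z * Im z = 0" "(Re z)\<^sup>2 < (Im z)\<^sup>2"
          by (auto simp: w_def power2_eq_square)
        thus False using z by simp
      qed
      moreover have "w' \<noteq> 0" using that z by (auto simp: w_def)
      ultimately show ?thesis using zeros by blast
    qed
    define u where "u = Od w *v v"
    have od: "det (Od w) \<noteq> 0" using not_zero[of w] by (simp add: mzeros_def Od_def)
    have u0: "u \<noteq> 0" using od v(1) by (auto simp: u_def det_eq_0_iff_kernel)
    have w0: "w \<noteq> 0" using not_zero[of w] by simp
    have "w *s (R w *v u) = z *s u"
      using Rtilde_mult_vec[OF w0 od[unfolded Od_def], of v] Ev
      by (simp add: R_def u_def E_def Od_def scale_matrix_vector_mult)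
    hence "w * hip u (R w *v u) = z * hip u u"
      by (metis hip_scale(2))
    hence "z * (z * hip u (R w *v u)) = z * hip u u" by (simp add: w_def power2_eq_square mult.assoc)
    hence "hip u (R w *v u) * z = hip u u" using z by (auto simp: mult.commute)
    hence "hip u (R w *v u) = hip u u / z" using z by (auto simp: eq_divide_eq)
    also have "\<dots> = of_real ((norm u)\<^sup>2 / (norm z)\<^sup>2) * cnj z"
      by (subst complex_div_cnj) (simp add: hip_self)
    finally have val: "hip u (R w *v u) = of_real ((norm u)\<^sup>2 / (norm z)\<^sup>2) * cnj z" .
    define q where "q = (norm u)\<^sup>2 / (norm z)\<^sup>2"
    have "z \<noteq> 0" using z by auto
    hence q: "q > 0" using u0 by (simp add: q_def)
    have Im_val: "Im (hip u (R w *v u)) = - q * Im z" and Re_val: "Re (hip u (R w *v u)) = q * Re z"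
      unfolding val q_def by simp_all
    have pos: "Im (hip x (R s *v x)) \<ge> 0" if "Im s > 0" for s x
      using herg that nonneg_definite_imaginary_part_iff
      unfolding herglotz_nevanlinna_def R_def by blast
    have refl: "hip x (R s *v x) = cnj (hip x (R (cnj s) *v x))" if "s \<notin> mzeros (odd_part F) \<union> {0}" for s x
    proof -
      have "ctranspose (R (cnj s)) = R s"
        using ctranspose_Rtilde_cnj[OF sa, of s] that by (simp add: R_def mzeros_def)
      thus ?thesis using hip_ctranspose_right[of x "R (cnj s)" x] by (simp add: cnj_hip)
    qed
    \<comment> \<open>Thus \<open>Im w\<close> has the sign of \<open>Im z\<close>, whereas by
      \<open>Im_val\<close> the form at \<open>w\<close> has an imaginary part of the opposite
      sign.\<close>
    have Imw: "Im w = 2 * Re z * Im z" by (simp add: w_def power2_eq_square)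
    consider "Im z > 0" | "Im z < 0" | "Im z = 0" by linarith
    thus False
    proof cases
      case 1
      hence "Im (hip u (R w *v u)) \<ge> 0" using z Imw by (intro pos) simp
      thus False using Im_val q 1 by (simp add: mult_le_0_iff)
    next
      case 2
      hence "Im (cnj w) > 0" using z Imw by (simp add: mult_pos_neg)
      from pos[OF this, of u] have "Im (hip u (R w *v u)) \<le> 0"
        using refl[OF not_zero[of w], of u] by simp
      thus False using Im_val q 2 by (simp add: zero_le_mult_iff)
    next
      case 3
      have nz: "of_real x \<notin> mzeros (odd_part F) \<union> {0}" if "x > 0" for x :: real
        using zeros[of "of_real x"] that by auto
      have "Re (hip u (R (of_real (Re w)) *v u)) \<le> 0"
      proof (rule herglotz_nonpos_of_limit[where f = "\<lambda>w. hip u (R w *v u)"])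
        show "(\<lambda>w. hip u (R w *v u)) field_differentiable at (of_real x)" if "x > 0" for x
          unfolding R_def using rmat_eval_Rtilde(1)[OF nz[OF that]]
          by (rule hip_rmat_eval_field_differentiable)
        show "Im (hip u (R (of_real x) *v u)) = 0" if "x > 0" for x
          using refl[OF nz[OF that], of u] by (simp add: complex_eq_iff)
        show "((\<lambda>x. Re (hip u (R (of_real x) *v u))) \<longlongrightarrow> Re (hip u (L *v u))) at_top"
          unfolding R_def
          by (intro tendsto_intros filterlim_compose[OF lim(1) filterlim_of_real_at_infinity])
        show "Re w > 0" using 3 z by (simp add: w_def power2_eq_square)
      qed (use pos lim(2) in auto)
      moreover have "of_real (Re w) = w" using 3 Imw by (simp add: complex_eq_iff)
      ultimately have "q * Re z \<le> 0" using Re_val by simp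
      thus False using q z by (simp add: mult_le_0_iff)
    qed
  qed
qed

theorem theorem3p7:
  fixes F :: "complex poly^'p^'p"
  assumes "mmonic F"
    and "mdegree F \<ge> 1"
    and "even (mdegree F) \<Longrightarrow> mregular (odd_part F)"
    and "rmat_self_adjoint (Rtilde F)"
  shows "(hurwitz_stable F \<longleftrightarrow>
            herglotz_nevanlinna (Rtilde F) \<and>
            right_coprime (even_part F) (odd_part F) \<and>
            (\<forall>z\<in>mzeros (odd_part F). z \<in> \<real> \<and> Re z < 0) \<and>
            0 \<notin> mzeros (even_part F) \<and>
            (even (mdegree F) \<longrightarrow>
              (\<exists>L. (rmat_eval (Rtilde F) \<longlongrightarrow> L) at_infinity \<and> neg_definite L)))
       \<and> (hurwitz_stable F \<longrightarrow> msimple (odd_part F))"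
    (is "(_ \<longleftrightarrow> ?conds) \<and> _")
proof -
  define n where "n = mdegree F"
  have monic: "mcoeff F n = mat 1" using assms(1) by (simp add: mmonic_def n_def)
  have above: "mcoeff F k = 0" if "k > n" for k
    using that by (simp add: n_def mcoeff_gt_mdegree)
  \<comment> \<open>In both parities \<open>d\<close> bounds the degree of the odd part: coefficient
    \<open>k\<close> of it is coefficient \<open>2 * k + 1\<close> of \<open>F\<close>, and
    \<open>2 * d + 1\<close> is the largest odd number up to \<open>n\<close>.\<close>
  define d where "d = (n - 1) div 2"
  have n: "n = (if even n then 2 * Suc d else 2 * d + 1)"
    using assms(2) unfolding n_def[symmetric] d_def by (auto elim!: evenE oddE)
  have reg: "det (odd_part F) \<noteq> 0"
  proof (cases "even n")
    case True
    thus ?thesis using assms(3) by (simp add: n_def mregular_def)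
  next
    case False
    hence "n = 2 * d + 1" using n by simp
    thus ?thesis
      using monic above by (intro det_mcoeff_neq_0_imp_regular[of d]) (simp_all add: mcoeff_odd_part)
  qed
  have stable_iff: "hurwitz_stable F \<longleftrightarrow> (\<forall>z. Re z \<ge> 0 \<longrightarrow> det (meval F z) \<noteq> 0)"
    using det_mcoeff_neq_0_imp_regular[of n F] monic above
    by (auto simp: hurwitz_stable_def mregular_def mzeros_def not_le[symmetric])
  have necessary: "?conds \<and> msimple (odd_part F)" if "hurwitz_stable F"
  proof -
    interpret stable_mpoly F n
      using that monic above reg hermitian_even_odd[OF assms(4)]
      by unfold_locales (auto simp: stable_iff mregular_def)
    have pole: "z \<notin> rmat_poles (Rtilde F)" if "Im z > 0" for z
      using zeros_odd_negative[of z] that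
      by (intro rmat_eval_Rtilde(1)) (auto simp: complex_is_Real_iff)
    hence "(\<lambda>z. rmat_eval (Rtilde F) z $ i $ j) holomorphic_on {z. Im z > 0}" for i j
      by (intro holomorphic_on_subset[OF rmat_eval_holomorphic]) auto
    hence "herglotz_nevanlinna (Rtilde F)"
      using pole Im_Rtilde_nonneg
      unfolding herglotz_nevanlinna_def nonneg_definite_imaginary_part_iff by auto
    moreover have "right_coprime (even_part F) (odd_part F)"
      unfolding right_coprime_iff_kernel[OF reg]
    \<comment> \<open>A common kernel vector at \<open>w\<close> is a kernel vector of
      \<open>F\<close> at either square root of \<open>w\<close>; the principal root lies in the
      closed right half-plane.\<close>
    proof (intro allI impI)
      fix w v
      assume "Ev w *v v = 0" "Od w *v v = 0"
      thus "v = 0"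
        using kernel_F[of "csqrt w" v] csqrt_principal[of w] by (auto simp: meval_even_odd[of F "csqrt w"])
    qed
    moreover have "0 \<notin> mzeros (even_part F)"
      using kernel_F[of 0] by (auto simp: mzeros_def det_eq_0_iff_kernel meval_even_odd[of F 0])
    moreover have "even n \<longrightarrow> (\<exists>L. (rmat_eval (Rtilde F) \<longlongrightarrow> L) at_infinity \<and> neg_definite L)"
      using Rtilde_limit_neg_definite[of d] n by presburger
    ultimately show ?thesis
      using zeros_odd_negative simple_odd by (auto simp: n_def)
  qed
  have sufficient: "hurwitz_stable F" if conds: ?conds
  proof -
    have "\<exists>L. (rmat_eval (Rtilde F) \<longlongrightarrow> L) at_infinity \<and> (\<forall>u. Re (hip u (L *v u)) \<le> 0)"
    proof (cases "even n")
      case True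
      then obtain L where "(rmat_eval (Rtilde F) \<longlongrightarrow> L) at_infinity" "neg_definite L"
        using conds by (auto simp: n_def)
      moreover have "Re (hip u (L *v u)) \<le> 0" for u
        using \<open>neg_definite L\<close> by (cases "u = 0") (auto simp: neg_definite_def sesq_form_eq_hip less_imp_le)
      ultimately show ?thesis by blast
    next
      case False
      hence "n = 2 * d + 1" using n by simp
      hence "(rmat_eval (Rtilde F) \<longlongrightarrow>
          - (mcoeff (even_part F) (Suc d) ** matrix_inv (mcoeff (odd_part F) d))) at_infinity"
        using monic above
        by (intro Rtilde_tendsto) (simp_all add: mcoeff_even_part mcoeff_odd_part)
      \<comment> \<open>This is coefficient \<open>2 * d + 2 = n + 1\<close> of \<open>F\<close>, so
        the limit at infinity is 0, which is enough for the monotonicity argument.\<close>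
      moreover have "mcoeff (even_part F) (Suc d) = 0"
        using above \<open>n = 2 * d + 1\<close> by (simp add: mcoeff_even_part)
      moreover have "0 ** A = 0" for A :: "complex^'p^'p"
        by (simp add: vec_eq_iff matrix_matrix_mult_def)
      ultimately have "(rmat_eval (Rtilde F) \<longlongrightarrow> 0) at_infinity"
        by simp
      thus ?thesis by (intro exI[of _ 0]) simp
    qed
    then obtain L where "(rmat_eval (Rtilde F) \<longlongrightarrow> L) at_infinity" "\<And>u. Re (hip u (L *v u)) \<le> 0"
      by blast
    from hurwitz_of_herglotz[OF assms(4) reg this] conds show ?thesis
      by (auto simp: stable_iff)
  qed
  show ?thesis using necessary sufficient by blast
qed

end
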